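(* Let $\Gamma$ be a group with identity $\epsilon$, let $R$ be a $\Gamma$-graded ring and $A$ a graded right $R$-module. Then $\mathrm{sr}(\mathrm{END}_R(A)_\epsilon)=1$ if and only if $A$ has graded substitution.
   Context: Rings are associative and unital; modules are right modules; $\Gamma$ is an arbitrary (not necessarily abelian) group. $\mathrm{END}_R(A)_\epsilon$ is the ring of graded endomorphisms of $A$, i.e. of those $f\in\mathrm{End}_R(A)$ with $f(A_\delta)\subseteq A_\delta$ for all $\delta\in\Gamma$. For a ring $T$, $\mathrm{sr}(T)=1$ (stable range 1) means: for all $x,y\in T$ with $xT+yT=T$ there is $u\in T$ such that $(x+yu)T=T$. $\cong_{\mathrm{gr}}$ denotes graded (degree-preserving) isomorphism. $A$ has graded substitution, $\mathrm{S}_{\mathrm{gr}}(A)$, if the following holds: whenever $A\oplus B=A'\oplus B'=M$ for some graded modules $M,A',B,B'$ (internal direct sums of graded submodules of $M$) and $A\cong_{\mathrm{gr}}A'$, there is a graded submodule $C$ of $M$ such that $B\oplus C=B'\oplus C=M$. *)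

theory Defs
  imports "HOL-Algebra.AbelCoset"
begin

text \<open>
  The library locale for modules is about left modules over commutative rings, so right modules
  over arbitrary rings are introduced here. As in the library record, the ring fields
  \<open>mult\<close> and \<open>one\<close> are unused.
\<close>

record ('r, 'm) right_module = "'m ring" +
  rsmult :: "'m \<Rightarrow> 'r \<Rightarrow> 'm" (infixl \<open>\<cdot>\<index>\<close> 70)

locale right_module = R?: ring R + M?: abelian_group M
  for R :: "'r ring" (structure) and M :: "('r, 'm) right_module" (structure) +
  assumes rsmult_closed:
      "\<lbrakk>x \<in> carrier M; r \<in> carrier R\<rbrakk> \<Longrightarrow> x \<cdot>\<^bsub>M\<^esub> r \<in> carrier M"
    and rsmult_l_distr:
      "\<lbrakk>x \<in> carrier M; y \<in> carrier M; r \<in> carrier R\<rbrakk> \<Longrightarrow>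
        (x \<oplus>\<^bsub>M\<^esub> y) \<cdot>\<^bsub>M\<^esub> r = x \<cdot>\<^bsub>M\<^esub> r \<oplus>\<^bsub>M\<^esub> y \<cdot>\<^bsub>M\<^esub> r"
    and rsmult_r_distr:
      "\<lbrakk>x \<in> carrier M; r \<in> carrier R; s \<in> carrier R\<rbrakk> \<Longrightarrow>
        x \<cdot>\<^bsub>M\<^esub> (r \<oplus>\<^bsub>R\<^esub> s) = x \<cdot>\<^bsub>M\<^esub> r \<oplus>\<^bsub>M\<^esub> x \<cdot>\<^bsub>M\<^esub> s"
    and rsmult_assoc:
      "\<lbrakk>x \<in> carrier M; r \<in> carrier R; s \<in> carrier R\<rbrakk> \<Longrightarrow>
        x \<cdot>\<^bsub>M\<^esub> (r \<otimes>\<^bsub>R\<^esub> s) = (x \<cdot>\<^bsub>M\<^esub> r) \<cdot>\<^bsub>M\<^esub> s"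
    and rsmult_one:
      "x \<in> carrier M \<Longrightarrow> x \<cdot>\<^bsub>M\<^esub> \<one>\<^bsub>R\<^esub> = x"

text \<open>
  The additive group of \<open>G\<close> is the internal direct sum of the subgroups \<open>N i\<close>: every element is in
  exactly one way a sum of elements of the \<open>N i\<close>, almost all of them zero.
\<close>

definition internal_direct_sum ::
    "('a, 'b) ring_scheme \<Rightarrow> 'i set \<Rightarrow> ('i \<Rightarrow> 'a set) \<Rightarrow> bool" where
  "internal_direct_sum G I N \<longleftrightarrow>
    (\<forall>i\<in>I. additive_subgroup (N i) G) \<and>
    (\<forall>x\<in>carrier G. \<exists>!c. c \<in> (\<Pi>\<^sub>E i\<in>I. N i) \<and> finite {i \<in> I. c i \<noteq> \<zero>\<^bsub>G\<^esub>} \<and>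
      x = (\<Oplus>\<^bsub>G\<^esub>i\<in>{i \<in> I. c i \<noteq> \<zero>\<^bsub>G\<^esub>}. c i))"

locale graded_ring = grading?: group \<Gamma> + R?: ring R
  for \<Gamma> :: "'g monoid" and R :: "'r ring" and Rg :: "'g \<Rightarrow> 'r set" +
  assumes ring_direct_sum: "internal_direct_sum R (carrier \<Gamma>) Rg"
    and ring_mult_degree:
      "\<lbrakk>\<gamma> \<in> carrier \<Gamma>; \<delta> \<in> carrier \<Gamma>; r \<in> Rg \<gamma>; s \<in> Rg \<delta>\<rbrakk> \<Longrightarrow>
        r \<otimes>\<^bsub>R\<^esub> s \<in> Rg (\<gamma> \<otimes>\<^bsub>\<Gamma>\<^esub> \<delta>)"

locale graded_module = graded_ring \<Gamma> R Rg + right_module R M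
  for \<Gamma> :: "'g monoid" and R :: "'r ring" and Rg :: "'g \<Rightarrow> 'r set"
    and M :: "('r, 'm) right_module" and Mg :: "'g \<Rightarrow> 'm set" +
  assumes module_direct_sum: "internal_direct_sum M (carrier \<Gamma>) Mg"
    and module_mult_degree:
      "\<lbrakk>\<gamma> \<in> carrier \<Gamma>; \<delta> \<in> carrier \<Gamma>; x \<in> Mg \<gamma>; r \<in> Rg \<delta>\<rbrakk> \<Longrightarrow>
        x \<cdot>\<^bsub>M\<^esub> r \<in> Mg (\<gamma> \<otimes>\<^bsub>\<Gamma>\<^esub> \<delta>)"

definition graded_submodule ::
    "'g monoid \<Rightarrow> 'r ring \<Rightarrow> ('r, 'm) right_module \<Rightarrow> ('g \<Rightarrow> 'm set) \<Rightarrow> 'm set \<Rightarrow> bool" where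
  "graded_submodule \<Gamma> R M Mg N \<longleftrightarrow>
    additive_subgroup N M \<and>
    (\<forall>x\<in>N. \<forall>r\<in>carrier R. x \<cdot>\<^bsub>M\<^esub> r \<in> N) \<and>
    internal_direct_sum (M\<lparr>carrier := N\<rparr>) (carrier \<Gamma>) (\<lambda>\<gamma>. N \<inter> Mg \<gamma>)"

definition direct_sum_of ::
    "('r, 'm) right_module \<Rightarrow> 'm set \<Rightarrow> 'm set \<Rightarrow> bool" where
  "direct_sum_of M N K \<longleftrightarrow> N <+>\<^bsub>M\<^esub> K = carrier M \<and> N \<inter> K = {\<zero>\<^bsub>M\<^esub>}"

definition right_module_hom ::
    "'r ring \<Rightarrow> ('r, 'a) right_module \<Rightarrow> ('r, 'b) right_module \<Rightarrow> ('a \<Rightarrow> 'b) set" where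
  "right_module_hom R M N = {f \<in> carrier M \<rightarrow> carrier N.
    (\<forall>x\<in>carrier M. \<forall>y\<in>carrier M. f (x \<oplus>\<^bsub>M\<^esub> y) = f x \<oplus>\<^bsub>N\<^esub> f y) \<and>
    (\<forall>x\<in>carrier M. \<forall>r\<in>carrier R. f (x \<cdot>\<^bsub>M\<^esub> r) = f x \<cdot>\<^bsub>N\<^esub> r)}"

definition graded_iso ::
    "'g monoid \<Rightarrow> 'r ring \<Rightarrow> ('r, 'a) right_module \<Rightarrow> ('g \<Rightarrow> 'a set) \<Rightarrow>
      ('r, 'b) right_module \<Rightarrow> ('g \<Rightarrow> 'b set) \<Rightarrow> bool" where
  "graded_iso \<Gamma> R M Mg N Ng \<longleftrightarrow>
    (\<exists>f \<in> right_module_hom R M N. bij_betw f (carrier M) (carrier N) \<and>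
      (\<forall>\<gamma>\<in>carrier \<Gamma>. f ` Mg \<gamma> = Ng \<gamma>))"

text \<open>
  Endomorphisms are represented by functions that are \<open>undefined\<close> outside the carrier, so that
  equality of endomorphisms is equality of functions.
\<close>

definition End_ring :: "'r ring \<Rightarrow> ('r, 'a) right_module \<Rightarrow> ('a \<Rightarrow> 'a) ring" where
  "End_ring R A =
    \<lparr>carrier = right_module_hom R A A \<inter> extensional (carrier A),
     mult = (\<lambda>f g. compose (carrier A) f g),
     one = (\<lambda>x\<in>carrier A. x),
     zero = (\<lambda>x\<in>carrier A. \<zero>\<^bsub>A\<^esub>),
     add = (\<lambda>f g. \<lambda>x\<in>carrier A. f x \<oplus>\<^bsub>A\<^esub> g x)\<rparr>"

definition graded_End_ring ::
    "'g monoid \<Rightarrow> 'r ring \<Rightarrow> ('r, 'a) right_module \<Rightarrow> ('g \<Rightarrow> 'a set) \<Rightarrow> ('a \<Rightarrow> 'a) ring" where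
  "graded_End_ring \<Gamma> R A Ag = (End_ring R A)
    \<lparr>carrier := {f \<in> carrier (End_ring R A). \<forall>\<delta>\<in>carrier \<Gamma>. f ` Ag \<delta> \<subseteq> Ag \<delta>}\<rparr>"

definition stable_range_one :: "('t, 'z) ring_scheme \<Rightarrow> bool" where
  "stable_range_one T \<longleftrightarrow>
    (\<forall>x\<in>carrier T. \<forall>y\<in>carrier T.
      (x <#\<^bsub>T\<^esub> carrier T) <+>\<^bsub>T\<^esub> (y <#\<^bsub>T\<^esub> carrier T) = carrier T \<longrightarrow>
      (\<exists>u\<in>carrier T. (x \<oplus>\<^bsub>T\<^esub> y \<otimes>\<^bsub>T\<^esub> u) <#\<^bsub>T\<^esub> carrier T = carrier T))"

text \<open>
  Graded substitution quantifies over all graded modules \<open>M\<close>; here \<open>M\<close> ranges over those with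
  elements of the type \<open>'m\<close>. Since the elements of \<open>M\<close> and of \<open>A\<close> need not have the same type, the
  summand ``\<open>A\<close>'' of \<open>M\<close> is a graded submodule \<open>A\<^sub>1\<close> of \<open>M\<close> that is graded isomorphic to \<open>A\<close>.
  As a quantifier over types is not available, the unrestricted notion is this property for all
  \<open>'m\<close>; note that for small \<open>'m\<close> it can hold vacuously, so that a type into which \<open>A \<oplus> A\<close> fits
  has to be among those considered.
\<close>

definition graded_substitution ::
    "'m itself \<Rightarrow> 'g monoid \<Rightarrow> 'r ring \<Rightarrow> ('g \<Rightarrow> 'r set) \<Rightarrow>
      ('r, 'a) right_module \<Rightarrow> ('g \<Rightarrow> 'a set) \<Rightarrow> bool" where
  "graded_substitution _ \<Gamma> R Rg A Ag \<longleftrightarrow>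
    (\<forall>(M :: ('r, 'm) right_module) Mg A\<^sub>1 B A' B'.
      graded_module \<Gamma> R Rg M Mg \<and>
      graded_submodule \<Gamma> R M Mg A\<^sub>1 \<and> graded_submodule \<Gamma> R M Mg B \<and>
      graded_submodule \<Gamma> R M Mg A' \<and> graded_submodule \<Gamma> R M Mg B' \<and>
      graded_iso \<Gamma> R A Ag (M\<lparr>carrier := A\<^sub>1\<rparr>) (\<lambda>\<gamma>. A\<^sub>1 \<inter> Mg \<gamma>) \<and>
      direct_sum_of M A\<^sub>1 B \<and> direct_sum_of M A' B' \<and>
      graded_iso \<Gamma> R A Ag (M\<lparr>carrier := A'\<rparr>) (\<lambda>\<gamma>. A' \<inter> Mg \<gamma>) \<longrightarrow>
      (\<exists>C. graded_submodule \<Gamma> R M Mg C \<and> direct_sum_of M B C \<and> direct_sum_of M B' C))"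

end

theory Submission
  imports Defs
begin

text \<open>
  Let \<open>E\<close> be the ring of graded endomorphisms of \<open>A\<close>. A graded summand of \<open>M\<close> isomorphic to \<open>A\<close>,
  with a complement \<open>B\<close>, amounts to graded maps \<open>i : A \<rightarrow> M\<close> and \<open>p : M \<rightarrow> A\<close> with \<open>p i = 1\<close> and
  \<open>ker p = B\<close>; the image of \<open>h : A \<rightarrow> M\<close> is a complement of \<open>B\<close> as soon as \<open>p h\<close> is bijective
  (this forces \<open>h\<close> to be injective).

  If \<open>E\<close> has stable range 1 and two such decompositions \<open>(i, p)\<close> and \<open>(j, q)\<close> are given, let
  \<open>e = 1 - j q\<close>. Then \<open>(p j) (q i) + (p e i) 1 = p i = 1\<close>, so \<open>p j + p e i u\<close> is a unit for some
  \<open>u\<close>. The map \<open>h = j + e i u\<close> satisfies \<open>p h = p j + p e i u\<close> and \<open>q h = 1\<close>, and its image is a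
  common complement. Conversely, if \<open>x a + y b = 1\<close> in \<open>E\<close>, then \<open>(x, y) : A \<oplus> A \<rightarrow> A\<close> is split by
  \<open>(a, b)\<close>. A common complement of its kernel and of \<open>0 \<oplus> A\<close> is the graph of some \<open>u\<close>, and
  \<open>x + y u\<close> is bijective.
\<close>

section \<open>Finite sums and internal direct sums in abelian groups\<close>

lemma abelian_group_hom_intro:
  assumes "abelian_group G" "abelian_group H"
    and "\<And>x. x \<in> carrier G \<Longrightarrow> h x \<in> carrier H"
    and "\<And>x y. \<lbrakk>x \<in> carrier G; y \<in> carrier G\<rbrakk> \<Longrightarrow> h (x \<oplus>\<^bsub>G\<^esub> y) = h x \<oplus>\<^bsub>H\<^esub> h y"
  shows "abelian_group_hom G H h"
  using assms
  by (intro abelian_group_homI group_hom.intro abelian_group.a_group group_hom_axioms.intro homI)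
    simp_all

text \<open>For infinite \<open>F\<close> both sides have the default value zero of
  \<open>finsum\<close>, so the induction covers every index set.\<close>

lemma (in abelian_group_hom) hom_finsum:
  assumes "c \<in> F \<rightarrow> carrier G"
  shows "h (finsum G c F) = finsum H (\<lambda>i. h (c i)) F"
  using assms
proof (induction F rule: infinite_finite_induct)
  case (insert i F)
  then have "c \<in> F \<rightarrow> carrier G" "c i \<in> carrier G" "(\<lambda>i. h (c i)) \<in> F \<rightarrow> carrier H"
    by (auto simp: Pi_iff)
  with insert show ?case by simp
qed simp_all

lemma (in abelian_group) minus_eq_zero_iff:
  "\<lbrakk>x \<in> carrier G; y \<in> carrier G\<rbrakk> \<Longrightarrow> x \<ominus> y = \<zero> \<longleftrightarrow> x = y"
  by (metis add.inv_closed add.m_comm local.minus_eq local.minus_minus minus_equality r_neg)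

lemma (in abelian_group) minus_eq_minusI:
  assumes "x \<oplus> y = z \<oplus> w" "x \<in> carrier G" "y \<in> carrier G" "z \<in> carrier G" "w \<in> carrier G"
  shows "x \<ominus> z = w \<ominus> y"
proof -
  have "(x \<ominus> z) \<oplus> y = \<ominus> z \<oplus> (x \<oplus> y)" using assms(2-) by (simp add: minus_eq a_ac)
  also have "\<dots> = (\<ominus> z \<oplus> z) \<oplus> w" unfolding assms(1) using assms(2-) by (simp add: a_assoc)
  finally have "w = (x \<ominus> z) \<oplus> y" using assms(2-) by (simp add: l_neg)
  moreover have "\<dots> \<ominus> y = (x \<ominus> z) \<oplus> (y \<ominus> y)" using assms(2-) by (simp add: minus_eq a_assoc)
  ultimately show ?thesis using assms(2-) by (metis minus_eq_zero_iff minus_closed r_zero)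
qed

text \<open>The definition of \<open>internal_direct_sum\<close> sums over supports. Any finite
  index set outside of which the family vanishes serves as well, so two families can be summed over
  one index set.\<close>

lemma (in abelian_group) finsum_support:
  assumes "finite F" "F \<subseteq> I" "c \<in> F \<rightarrow> carrier G" "\<And>i. i \<in> I - F \<Longrightarrow> c i = \<zero>"
  shows "finite {i \<in> I. c i \<noteq> \<zero>}" "(\<Oplus>i\<in>{i \<in> I. c i \<noteq> \<zero>}. c i) = finsum G c F"
proof -
  have sub: "{i \<in> I. c i \<noteq> \<zero>} \<subseteq> F" using assms(4) by blast
  then show "finite {i \<in> I. c i \<noteq> \<zero>}" using assms(1) by (rule finite_subset)
  show "(\<Oplus>i\<in>{i \<in> I. c i \<noteq> \<zero>}. c i) = finsum G c F"
    by (rule add.finprod_mono_neutral_cong_left) (use assms sub in auto)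
qed

text \<open>Existence of a representation is spanning, and uniqueness amounts to independence
  because two representations differ by one of zero. Families on finite index sets are easier to
  transport along homomorphisms, which may change supports.\<close>

lemma (in abelian_group) internal_direct_sum_iff:
  "internal_direct_sum G I N \<longleftrightarrow>
    (\<forall>i\<in>I. additive_subgroup (N i) G) \<and>
    (\<forall>x\<in>carrier G. \<exists>c F. finite F \<and> F \<subseteq> I \<and> c \<in> Pi F N \<and> x = finsum G c F) \<and>
    (\<forall>c F. finite F \<and> F \<subseteq> I \<and> c \<in> Pi F N \<and> finsum G c F = \<zero> \<longrightarrow> (\<forall>i\<in>F. c i = \<zero>))"
    (is "_ \<longleftrightarrow> ?sub \<and> ?span \<and> ?indep")
proof (cases ?sub)
  case True
  have carr: "x \<in> carrier G" if "i \<in> I" "x \<in> N i" for i x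
    using True that additive_subgroup.a_subset by blast
  have zero: "\<zero> \<in> N i" if "i \<in> I" for i
    using True that additive_subgroup.zero_closed by blast
  have diff: "x \<ominus> y \<in> N i" if "i \<in> I" "x \<in> N i" "y \<in> N i" for i x y
    using True that carr
    by (simp add: minus_eq additive_subgroup.a_closed additive_subgroup.a_inv_closed)
  let ?rep = "\<lambda>x c. c \<in> (\<Pi>\<^sub>E i\<in>I. N i) \<and> finite {i \<in> I. c i \<noteq> \<zero>} \<and>
      x = (\<Oplus>i\<in>{i \<in> I. c i \<noteq> \<zero>}. c i)"
  \<comment> \<open>Extension by zero turns a finite family into a representation in the sense of
    the definition. Both directions use it.\<close>
  have extend: "?rep (finsum G c F) (\<lambda>i\<in>I. if i \<in> F then c i else \<zero>)"
    if "finite F" "F \<subseteq> I" "c \<in> Pi F N" for c F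
  proof -
    let ?c = "\<lambda>i\<in>I. if i \<in> F then c i else \<zero>"
    have c: "c \<in> F \<rightarrow> carrier G" using that carr by blast
    have "finsum G ?c F = finsum G c F"
      by (rule add.finprod_cong') (use that c in auto)
    moreover have "?c \<in> (\<Pi>\<^sub>E i\<in>I. N i)" using that zero by auto
    moreover have "?c \<in> F \<rightarrow> carrier G" using that c by auto
    moreover have "\<And>i. i \<in> I - F \<Longrightarrow> ?c i = \<zero>" by simp
    ultimately show ?thesis
      using finsum_support[of F I ?c] that by (simp only: simp_thms)
  qed
  show ?thesis
  proof
    assume ids: "internal_direct_sum G I N"
    then have uniq: "\<exists>!c. ?rep x c" if "x \<in> carrier G" for x
      using that unfolding internal_direct_sum_def by blast
    have ?span
    proof
      fix x assume "x \<in> carrier G"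
      then obtain c where "?rep x c" using uniq by blast
      then show "\<exists>c F. finite F \<and> F \<subseteq> I \<and> c \<in> Pi F N \<and> x = finsum G c F"
        by (intro exI[of _ c] exI[of _ "{i \<in> I. c i \<noteq> \<zero>}"]) auto
    qed
    moreover have ?indep
    proof (intro allI impI ballI)
      fix c F i
      assume *: "finite F \<and> F \<subseteq> I \<and> c \<in> Pi F N \<and> finsum G c F = \<zero>" and i: "i \<in> F"
      have "?rep \<zero> (\<lambda>i\<in>I. if i \<in> F then c i else \<zero>)" using extend[of F c] * by simp
      \<comment> \<open>The empty family is a second representation of zero.\<close>
      moreover have "?rep \<zero> (\<lambda>i\<in>I. if i \<in> {} then c i else \<zero>)" using extend[of "{}" c] by simp
      ultimately have "(\<lambda>i\<in>I. if i \<in> F then c i else \<zero>) = (\<lambda>i\<in>I. if i \<in> {} then c i else \<zero>)"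
        using uniq[of \<zero>] by blast
      from fun_cong[OF this, of i] show "c i = \<zero>" using i * by auto
    qed
    ultimately show "?sub \<and> ?span \<and> ?indep" using True by blast
  next
    assume *: "?sub \<and> ?span \<and> ?indep"
    have "\<exists>!c. ?rep x c" if x: "x \<in> carrier G" for x
    proof (rule ex_ex1I)
      obtain c F where F: "finite F" "F \<subseteq> I" "c \<in> Pi F N" and eq: "x = finsum G c F"
        using * x by meson
      show "\<exists>c. ?rep x c" 
        unfolding eq using extend[OF F]
        by (rule exI[where x = "\<lambda>i\<in>I. if i \<in> F then c i else \<zero>"])
    next
      fix c d assume c: "?rep x c" and d: "?rep x d"
      \<comment> \<open>Over the union of the two supports both representations are sums over the
        same set, and the family of differences sums to zero.\<close>
      define F where "F = {i \<in> I. c i \<noteq> \<zero>} \<union> {i \<in> I. d i \<noteq> \<zero>}"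
      have F: "finite F" "F \<subseteq> I" using c d unfolding F_def by auto
      have cF: "c \<in> F \<rightarrow> carrier G" "d \<in> F \<rightarrow> carrier G"
        using c d F carr by (auto simp: PiE_iff)
      have "finsum G c F = x" "finsum G d F = x"
        using c d finsum_support(2)[OF F cF(1)] finsum_support(2)[OF F cF(2)]
        by (auto simp: F_def)
      moreover have "finsum G c F = finsum G (\<lambda>i. c i \<ominus> d i) F \<oplus> finsum G d F"
      proof -
        have "finsum G c F = finsum G (\<lambda>i. (c i \<ominus> d i) \<oplus> d i) F"
          using cF by (intro finsum_cong') (auto simp: Pi_iff minus_eq a_assoc l_neg)
        also have "\<dots> = finsum G (\<lambda>i. c i \<ominus> d i) F \<oplus> finsum G d F"
          using cF by (intro finsum_addf) auto
        finally show ?thesis .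
      qed
      moreover have "finsum G (\<lambda>i. c i \<ominus> d i) F \<in> carrier G"
        using cF by (intro finsum_closed) auto
      ultimately have "finsum G (\<lambda>i. c i \<ominus> d i) F = \<zero>"
        using x by (metis add.l_cancel_one add.m_comm)
      moreover have "(\<lambda>i. c i \<ominus> d i) \<in> Pi F N" using c d F diff by (auto simp: PiE_iff)
      ultimately have "\<forall>i\<in>F. c i \<ominus> d i = \<zero>" using * F by blast
      then have "c i = d i" if "i \<in> F" for i
        using that cF by (simp add: Pi_iff minus_eq_zero_iff)
      moreover have "c i = d i" if "i \<in> I" "i \<notin> F" for i
        using that unfolding F_def by simp
      ultimately have "c i = d i" if "i \<in> I" for i
        using that by blast
      then show "c = d" using c d by (intro extensionalityI[of _ I]) (auto simp: PiE_iff)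
    qed
    then show "internal_direct_sum G I N" using True unfolding internal_direct_sum_def by blast
  qed
qed (unfold internal_direct_sum_def, blast)

lemma abelian_group_additive_subgroup:
  assumes "abelian_group M" "additive_subgroup N M"
  shows "abelian_group (M\<lparr>carrier := N\<rparr>)"
proof -
  interpret abelian_group M by fact
  interpret N: additive_subgroup N M by fact
  show ?thesis
  proof (rule abelian_groupI; simp)
    fix x assume "x \<in> N"
    then show "\<exists>y\<in>N. y \<oplus>\<^bsub>M\<^esub> x = \<zero>\<^bsub>M\<^esub>"
      using N.a_subset by (intro bexI[of _ "\<ominus>\<^bsub>M\<^esub> x"]) (auto simp: l_neg)
  qed (use N.a_subset in \<open>auto simp: a_ac\<close>)
qed

definition graded_hom ::
    "'g monoid \<Rightarrow> 'r ring \<Rightarrow> ('r, 'a) right_module \<Rightarrow> ('g \<Rightarrow> 'a set) \<Rightarrow>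
      ('r, 'b) right_module \<Rightarrow> ('g \<Rightarrow> 'b set) \<Rightarrow> ('a \<Rightarrow> 'b) set" where
  "graded_hom \<Gamma> R M Mg N Ng =
    {f \<in> right_module_hom R M N. \<forall>\<gamma>\<in>carrier \<Gamma>. f ` Mg \<gamma> \<subseteq> Ng \<gamma>}"

text \<open>The external direct sum. It serves to rebuild a module from a copy of \<open>A\<close>
  and a complement, and as the test module \<open>A \<oplus> A\<close> from which stable range 1 is
  derived.\<close>

definition prod_module ::
    "('r, 'a) right_module \<Rightarrow> ('r, 'b) right_module \<Rightarrow> ('r, 'a \<times> 'b) right_module" where
  "prod_module M N =
    \<lparr>carrier = carrier M \<times> carrier N, mult = undefined, one = undefined,
     zero = (\<zero>\<^bsub>M\<^esub>, \<zero>\<^bsub>N\<^esub>),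
     add = (\<lambda>x y. (fst x \<oplus>\<^bsub>M\<^esub> fst y, snd x \<oplus>\<^bsub>N\<^esub> snd y)),
     rsmult = (\<lambda>x r. (fst x \<cdot>\<^bsub>M\<^esub> r, snd x \<cdot>\<^bsub>N\<^esub> r))\<rparr>"

lemma prod_module_simps [simp]:
  "carrier (prod_module M N) = carrier M \<times> carrier N"
  "\<zero>\<^bsub>prod_module M N\<^esub> = (\<zero>\<^bsub>M\<^esub>, \<zero>\<^bsub>N\<^esub>)"
  "x \<oplus>\<^bsub>prod_module M N\<^esub> y = (fst x \<oplus>\<^bsub>M\<^esub> fst y, snd x \<oplus>\<^bsub>N\<^esub> snd y)"
  "x \<cdot>\<^bsub>prod_module M N\<^esub> r = (fst x \<cdot>\<^bsub>M\<^esub> r, snd x \<cdot>\<^bsub>N\<^esub> r)"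
  by (simp_all add: prod_module_def)

lemma abelian_group_prod_module:
  assumes "abelian_group M" "abelian_group N"
  shows "abelian_group (prod_module M N)"
proof -
  interpret M: abelian_group M by fact
  interpret N: abelian_group N by fact
  show ?thesis
  proof (rule abelian_groupI)
    fix x assume "x \<in> carrier (prod_module M N)"
    then show "\<exists>y\<in>carrier (prod_module M N). y \<oplus>\<^bsub>prod_module M N\<^esub> x = \<zero>\<^bsub>prod_module M N\<^esub>"
      by (intro bexI[of _ "(\<ominus>\<^bsub>M\<^esub> fst x, \<ominus>\<^bsub>N\<^esub> snd x)"]) (auto simp: M.l_neg N.l_neg)
  qed (auto simp: M.a_ac N.a_ac)
qed

section \<open>Graded modules and their homogeneous components\<close>

context graded_ring
begin

abbreviation "gmod \<equiv> graded_module \<Gamma> R Rg"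
abbreviation "ghom \<equiv> graded_hom \<Gamma> R"
abbreviation "gsub \<equiv> graded_submodule \<Gamma> R"

lemma gmod_abelian_group: "gmod M Mg \<Longrightarrow> abelian_group M"
  by (simp add: graded_module_def right_module_def)

lemma gmod_smult:
  assumes "gmod M Mg" "x \<in> carrier M" "r \<in> carrier R"
  shows "x \<cdot>\<^bsub>M\<^esub> r \<in> carrier M"
    and "\<zero>\<^bsub>M\<^esub> \<cdot>\<^bsub>M\<^esub> r = \<zero>\<^bsub>M\<^esub>"
    and "(\<ominus>\<^bsub>M\<^esub> x) \<cdot>\<^bsub>M\<^esub> r = \<ominus>\<^bsub>M\<^esub> (x \<cdot>\<^bsub>M\<^esub> r)"
proof -
  interpret M: right_module R M using assms(1) by (simp add: graded_module_def)
  show "x \<cdot>\<^bsub>M\<^esub> r \<in> carrier M" using assms by (simp add: M.rsmult_closed)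
  have "\<zero>\<^bsub>M\<^esub> \<cdot>\<^bsub>M\<^esub> r \<oplus>\<^bsub>M\<^esub> \<zero>\<^bsub>M\<^esub> \<cdot>\<^bsub>M\<^esub> r = \<zero>\<^bsub>M\<^esub> \<cdot>\<^bsub>M\<^esub> r"
    using assms M.rsmult_l_distr[of "\<zero>\<^bsub>M\<^esub>" "\<zero>\<^bsub>M\<^esub>" r] by simp
  then show zero: "\<zero>\<^bsub>M\<^esub> \<cdot>\<^bsub>M\<^esub> r = \<zero>\<^bsub>M\<^esub>"
    using assms M.rsmult_closed M.M.add.l_cancel_one by blast
  have "(\<ominus>\<^bsub>M\<^esub> x) \<cdot>\<^bsub>M\<^esub> r \<oplus>\<^bsub>M\<^esub> x \<cdot>\<^bsub>M\<^esub> r = \<zero>\<^bsub>M\<^esub>"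
    using assms M.rsmult_l_distr[of "\<ominus>\<^bsub>M\<^esub> x" x r] by (simp add: M.M.l_neg zero)
  then show "(\<ominus>\<^bsub>M\<^esub> x) \<cdot>\<^bsub>M\<^esub> r = \<ominus>\<^bsub>M\<^esub> (x \<cdot>\<^bsub>M\<^esub> r)"
    using assms M.rsmult_closed M.M.minus_equality by force
qed

lemma gmod_degree:
  assumes "gmod M Mg" "\<gamma> \<in> carrier \<Gamma>"
  shows "additive_subgroup (Mg \<gamma>) M" "Mg \<gamma> \<subseteq> carrier M" "\<zero>\<^bsub>M\<^esub> \<in> Mg \<gamma>"
    and "\<lbrakk>x \<in> Mg \<gamma>; y \<in> Mg \<gamma>\<rbrakk> \<Longrightarrow> x \<oplus>\<^bsub>M\<^esub> y \<in> Mg \<gamma>"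
    and "x \<in> Mg \<gamma> \<Longrightarrow> \<ominus>\<^bsub>M\<^esub> x \<in> Mg \<gamma>"
proof -
  show *: "additive_subgroup (Mg \<gamma>) M"
    using assms by (simp add: graded_module_def graded_module_axioms_def internal_direct_sum_def)
  interpret additive_subgroup "Mg \<gamma>" M by fact
  interpret M: abelian_group M using assms(1) by (rule gmod_abelian_group)
  show "Mg \<gamma> \<subseteq> carrier M" "\<zero>\<^bsub>M\<^esub> \<in> Mg \<gamma>" by (auto intro: a_subset)
  show "\<lbrakk>x \<in> Mg \<gamma>; y \<in> Mg \<gamma>\<rbrakk> \<Longrightarrow> x \<oplus>\<^bsub>M\<^esub> y \<in> Mg \<gamma>" by simp
  show "x \<in> Mg \<gamma> \<Longrightarrow> \<ominus>\<^bsub>M\<^esub> x \<in> Mg \<gamma>" using a_inv_closed by blast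
qed

lemma gmod_span:
  assumes "gmod M Mg" "x \<in> carrier M"
  obtains c F where "finite F" "F \<subseteq> carrier \<Gamma>" "c \<in> Pi F Mg" "c \<in> F \<rightarrow> carrier M" "x = finsum M c F"
proof -
  interpret M: abelian_group M using assms(1) by (rule gmod_abelian_group)
  have "internal_direct_sum M (carrier \<Gamma>) Mg"
    using assms by (simp add: graded_module_def graded_module_axioms_def)
  then obtain c F where *: "finite F" "F \<subseteq> carrier \<Gamma>" "c \<in> Pi F Mg" "x = finsum M c F"
    using assms(2) unfolding M.internal_direct_sum_iff by meson
  moreover have "c \<in> F \<rightarrow> carrier M" using * gmod_degree(2)[OF assms(1)] by blast
  ultimately show thesis using that by blast
qed

lemma gmod_indep:
  assumes "gmod M Mg" "finite F" "F \<subseteq> carrier \<Gamma>" "c \<in> Pi F Mg" "finsum M c F = \<zero>\<^bsub>M\<^esub>" "i \<in> F"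
  shows "c i = \<zero>\<^bsub>M\<^esub>"
proof -
  interpret M: abelian_group M using assms(1) by (rule gmod_abelian_group)
  have "internal_direct_sum M (carrier \<Gamma>) Mg"
    using assms by (simp add: graded_module_def graded_module_axioms_def)
  then show ?thesis using assms unfolding M.internal_direct_sum_iff by blast
qed

text \<open>By uniqueness of components, an element of degree \<open>\<gamma>\<close> has no
  component in any other degree. This is how inverse maps are shown to respect degrees.\<close>

lemma finsum_homogeneous_iff:
  assumes M: "gmod M Mg" and F: "finite F" "F \<subseteq> carrier \<Gamma>" and c: "c \<in> Pi F Mg"
    and \<gamma>: "\<gamma> \<in> carrier \<Gamma>"
  shows "finsum M c F \<in> Mg \<gamma> \<longleftrightarrow> (\<forall>i\<in>F - {\<gamma>}. c i = \<zero>\<^bsub>M\<^esub>)"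
proof -
  interpret M: abelian_group M using M by (rule gmod_abelian_group)
  have cM: "c \<in> F \<rightarrow> carrier M" using c F gmod_degree(2)[OF M] by blast
  \<comment> \<open>\<open>z\<close> is the component in degree \<open>\<gamma>\<close>, or zero if
    \<open>\<gamma>\<close> is outside \<open>F\<close>; from here on both cases are treated
    together.\<close>
  obtain z where z: "z \<in> Mg \<gamma>" and sum: "finsum M c F = z \<oplus>\<^bsub>M\<^esub> finsum M c (F - {\<gamma>})"
  proof (cases "\<gamma> \<in> F")
    case True
    then have "finsum M c F = c \<gamma> \<oplus>\<^bsub>M\<^esub> finsum M c (F - {\<gamma>})"
      using F cM M.finsum_insert[of "F - {\<gamma>}" \<gamma> c] by (auto simp: insert_absorb Pi_iff)
    then show ?thesis using that[of "c \<gamma>"] True c by blast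
  next
    case False
    then show ?thesis using that[of "\<zero>\<^bsub>M\<^esub>"] gmod_degree(3)[OF M \<gamma>] cM by simp
  qed
  have zM: "z \<in> carrier M" using z gmod_degree(2)[OF M \<gamma>] by blast
  have restM: "finsum M c (F - {\<gamma>}) \<in> carrier M" using cM by (intro M.finsum_closed) auto
  show ?thesis
  proof
    assume x: "finsum M c F \<in> Mg \<gamma>"
    then have xM: "finsum M c F \<in> carrier M" using gmod_degree(2)[OF M \<gamma>] by blast
    \<comment> \<open>Subtracting the sum, itself of degree \<open>\<gamma>\<close>, in its own
      degree gives a family with sum zero that agrees with \<open>c\<close> in all other degrees.
      Independence then applies.\<close>
    define d where "d = c(\<gamma> := \<ominus>\<^bsub>M\<^esub> finsum M c F \<oplus>\<^bsub>M\<^esub> z)"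
    have "d \<in> Pi (insert \<gamma> (F - {\<gamma>})) Mg"
      using c x z gmod_degree(4,5)[OF M \<gamma>] by (auto simp: d_def Pi_iff)
    moreover have "finsum M d (insert \<gamma> (F - {\<gamma>})) = \<zero>\<^bsub>M\<^esub>"
    proof -
      have "finsum M d (F - {\<gamma>}) = finsum M c (F - {\<gamma>})"
        using cM by (intro M.finsum_cong') (auto simp: d_def)
      moreover have "d \<in> F - {\<gamma>} \<rightarrow> carrier M" "d \<gamma> \<in> carrier M"
        using cM xM zM by (auto simp: d_def)
      ultimately have "finsum M d (insert \<gamma> (F - {\<gamma>})) =
          d \<gamma> \<oplus>\<^bsub>M\<^esub> finsum M c (F - {\<gamma>})"
        using F M.finsum_insert[of "F - {\<gamma>}" \<gamma> d] by (metis finite_Diff Diff_iff singletonI)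
      also have "\<dots> = (\<ominus>\<^bsub>M\<^esub> finsum M c F \<oplus>\<^bsub>M\<^esub> z) \<oplus>\<^bsub>M\<^esub> finsum M c (F - {\<gamma>})"
        by (simp add: d_def)
      also have "\<dots> = \<ominus>\<^bsub>M\<^esub> finsum M c F \<oplus>\<^bsub>M\<^esub> (z \<oplus>\<^bsub>M\<^esub> finsum M c (F - {\<gamma>}))"
        using xM zM restM by (simp add: M.a_assoc)
      also have "\<dots> = \<zero>\<^bsub>M\<^esub>" using xM sum by (metis M.l_neg)
      finally show ?thesis .
    qed
    ultimately have "d i = \<zero>\<^bsub>M\<^esub>" if "i \<in> insert \<gamma> (F - {\<gamma>})" for i
      using gmod_indep[OF M, of "insert \<gamma> (F - {\<gamma>})" d i] F \<gamma> that by blast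
    then show "\<forall>i\<in>F - {\<gamma>}. c i = \<zero>\<^bsub>M\<^esub>"
      by (metis DiffE d_def fun_upd_other insertCI)
  next
    assume "\<forall>i\<in>F - {\<gamma>}. c i = \<zero>\<^bsub>M\<^esub>"
    then have "finsum M c (F - {\<gamma>}) = finsum M (\<lambda>i. \<zero>\<^bsub>M\<^esub>) (F - {\<gamma>})"
      by (intro M.finsum_cong') auto
    then show "finsum M c F \<in> Mg \<gamma>" using sum z zM by simp
  qed
qed

section \<open>Graded homomorphisms\<close>

lemma graded_homI:
  assumes "\<And>x. x \<in> carrier M \<Longrightarrow> f x \<in> carrier N"
    and "\<And>x y. \<lbrakk>x \<in> carrier M; y \<in> carrier M\<rbrakk> \<Longrightarrow> f (x \<oplus>\<^bsub>M\<^esub> y) = f x \<oplus>\<^bsub>N\<^esub> f y"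
    and "\<And>x r. \<lbrakk>x \<in> carrier M; r \<in> carrier R\<rbrakk> \<Longrightarrow> f (x \<cdot>\<^bsub>M\<^esub> r) = f x \<cdot>\<^bsub>N\<^esub> r"
    and "\<And>\<gamma> x. \<lbrakk>\<gamma> \<in> carrier \<Gamma>; x \<in> Mg \<gamma>\<rbrakk> \<Longrightarrow> f x \<in> Ng \<gamma>"
  shows "f \<in> ghom M Mg N Ng"
  using assms by (auto simp: graded_hom_def right_module_hom_def)

lemma graded_homD:
  assumes "f \<in> ghom M Mg N Ng"
  shows "x \<in> carrier M \<Longrightarrow> f x \<in> carrier N"
    and "\<lbrakk>x \<in> carrier M; y \<in> carrier M\<rbrakk> \<Longrightarrow> f (x \<oplus>\<^bsub>M\<^esub> y) = f x \<oplus>\<^bsub>N\<^esub> f y"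
    and "\<lbrakk>x \<in> carrier M; r \<in> carrier R\<rbrakk> \<Longrightarrow> f (x \<cdot>\<^bsub>M\<^esub> r) = f x \<cdot>\<^bsub>N\<^esub> r"
    and "\<lbrakk>\<gamma> \<in> carrier \<Gamma>; x \<in> Mg \<gamma>\<rbrakk> \<Longrightarrow> f x \<in> Ng \<gamma>"
  using assms by (auto simp: graded_hom_def right_module_hom_def image_subset_iff)

lemma graded_hom_abelian_group_hom:
  assumes "gmod M Mg" "gmod N Ng" "f \<in> ghom M Mg N Ng"
  shows "abelian_group_hom M N f"
  using assms
  by (intro abelian_group_hom_intro gmod_abelian_group) (auto dest: graded_homD)

lemma graded_hom_id: "(\<lambda>x. x) \<in> ghom M Mg M Mg"
  by (rule graded_homI) simp_all

lemma graded_hom_comp: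
  "\<lbrakk>g \<in> ghom M Mg N Ng; f \<in> ghom L Lg M Mg\<rbrakk> \<Longrightarrow> (\<lambda>x. g (f x)) \<in> ghom L Lg N Ng"
  by (rule graded_homI) (simp_all add: graded_homD)

lemma graded_hom_add:
  assumes N: "gmod N Ng" and f: "f \<in> ghom M Mg N Ng" and g: "g \<in> ghom M Mg N Ng"
  shows "(\<lambda>x. f x \<oplus>\<^bsub>N\<^esub> g x) \<in> ghom M Mg N Ng"
proof -
  interpret N: right_module R N using N by (simp add: graded_module_def)
  show ?thesis
    by (rule graded_homI)
      (simp_all add: graded_homD[OF f] graded_homD[OF g] N.M.a_ac N.rsmult_l_distr gmod_degree[OF N])
qed

lemma graded_hom_minus:
  assumes N: "gmod N Ng" and f: "f \<in> ghom M Mg N Ng" and g: "g \<in> ghom M Mg N Ng"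
  shows "(\<lambda>x. f x \<ominus>\<^bsub>N\<^esub> g x) \<in> ghom M Mg N Ng"
proof -
  interpret N: right_module R N using N by (simp add: graded_module_def)
  have "(\<lambda>x. \<ominus>\<^bsub>N\<^esub> g x) \<in> ghom M Mg N Ng"
    by (rule graded_homI)
      (simp_all add: graded_homD[OF g] N.M.minus_add gmod_smult[OF N] gmod_degree[OF N])
  from graded_hom_add[OF N f this] show ?thesis by (simp add: N.M.minus_eq)
qed

text \<open>Homogeneous components lie in the carrier, so the values there decide all conditions.
  This permits replacing a map by its restriction.\<close>

lemma graded_hom_cong:
  assumes "gmod M Mg" "f \<in> ghom M Mg N Ng" "\<And>x. x \<in> carrier M \<Longrightarrow> g x = f x"
  shows "g \<in> ghom M Mg N Ng"
proof -
  interpret M: right_module R M using assms(1) by (simp add: graded_module_def)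
  show ?thesis
  proof (rule graded_homI)
    fix \<gamma> x assume "\<gamma> \<in> carrier \<Gamma>" "x \<in> Mg \<gamma>"
    then show "g x \<in> Ng \<gamma>"
      using gmod_degree(2)[OF assms(1)] graded_homD(4)[OF assms(2)] assms(3) by (metis subsetD)
  qed (simp_all add: assms(3) graded_homD[OF assms(2)] M.rsmult_closed)
qed

lemma graded_hom_zero_minus:
  assumes "gmod M Mg" "gmod N Ng" "f \<in> ghom M Mg N Ng"
  shows "f \<zero>\<^bsub>M\<^esub> = \<zero>\<^bsub>N\<^esub>"
    and "\<lbrakk>x \<in> carrier M; y \<in> carrier M\<rbrakk> \<Longrightarrow> f (x \<ominus>\<^bsub>M\<^esub> y) = f x \<ominus>\<^bsub>N\<^esub> f y"
proof -
  interpret abelian_group_hom M N f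
    using assms by (rule graded_hom_abelian_group_hom)
  show "f \<zero>\<^bsub>M\<^esub> = \<zero>\<^bsub>N\<^esub>" by simp
  show "\<lbrakk>x \<in> carrier M; y \<in> carrier M\<rbrakk> \<Longrightarrow> f (x \<ominus>\<^bsub>M\<^esub> y) = f x \<ominus>\<^bsub>N\<^esub> f y"
    by (simp add: G.minus_eq H.minus_eq)
qed

text \<open>Additivity and linearity of the inverse are checked after applying \<open>f\<close>. For
  degrees, split the preimage of a homogeneous element: its components are sent to the components of
  that element, those in other degrees go to zero, and injectivity makes them zero.\<close>

lemma graded_hom_inverse:
  assumes M: "gmod M Mg" and N: "gmod N Ng" and f: "f \<in> ghom M Mg N Ng"
    and bij: "bij_betw f (carrier M) (carrier N)"
  shows "inv_into (carrier M) f \<in> ghom N Ng M Mg"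
proof -
  interpret f: abelian_group_hom M N f
    using M N f by (rule graded_hom_abelian_group_hom)
  interpret M: right_module R M using M by (simp add: graded_module_def)
  have inj: "\<lbrakk>f x = f y; x \<in> carrier M; y \<in> carrier M\<rbrakk> \<Longrightarrow> x = y" for x y
    using bij by (meson bij_betw_imp_inj_on inj_onD)
  define g where "g = inv_into (carrier M) f"
  have g: "g y \<in> carrier M" "f (g y) = y" if "y \<in> carrier N" for y
    using bij that by (auto simp: g_def bij_betw_def f_inv_into_f inv_into_into)
  have "g \<in> ghom N Ng M Mg"
  proof (rule graded_homI)
    fix y z assume "y \<in> carrier N" "z \<in> carrier N"
    then show "g (y \<oplus>\<^bsub>N\<^esub> z) = g y \<oplus>\<^bsub>M\<^esub> g z" by (intro inj) (simp_all add: g)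
  next
    fix y r assume y: "y \<in> carrier N" and r: "r \<in> carrier R"
    interpret N: right_module R N using N by (simp add: graded_module_def)
    show "g (y \<cdot>\<^bsub>N\<^esub> r) = g y \<cdot>\<^bsub>M\<^esub> r"
      using y r by (intro inj) (simp_all add: g graded_homD(3)[OF f] M.rsmult_closed N.rsmult_closed)
  next
    fix \<gamma> y assume \<gamma>: "\<gamma> \<in> carrier \<Gamma>" and y: "y \<in> Ng \<gamma>"
    then have yN: "y \<in> carrier N" using gmod_degree(2)[OF N \<gamma>] by blast
    obtain c F where F: "finite F" "F \<subseteq> carrier \<Gamma>" and c: "c \<in> Pi F Mg" "c \<in> F \<rightarrow> carrier M"
      and eq: "g y = finsum M c F"
      by (rule gmod_span[OF M g(1)[OF yN]])
    have "y = finsum N (\<lambda>i. f (c i)) F"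
      using f.hom_finsum[OF c(2)] g(2)[OF yN] eq by simp
    moreover have fc: "(\<lambda>i. f (c i)) \<in> Pi F Ng" using c(1) F graded_homD(4)[OF f] by blast
    ultimately have zero: "\<forall>i\<in>F - {\<gamma>}. f (c i) = \<zero>\<^bsub>N\<^esub>"
      using y finsum_homogeneous_iff[OF N F fc \<gamma>] by simp
    have "\<forall>i\<in>F - {\<gamma>}. c i = \<zero>\<^bsub>M\<^esub>"
    proof
      fix i assume "i \<in> F - {\<gamma>}"
      then show "c i = \<zero>\<^bsub>M\<^esub>" using zero c(2) by (intro inj) auto
    qed
    then show "g y \<in> Mg \<gamma>" using finsum_homogeneous_iff[OF M F c(1) \<gamma>] eq by simp
  qed (rule g)
  then show ?thesis by (simp add: g_def)
qed

section \<open>Graded submodules\<close>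

lemma gsub_subset: "gsub M Mg N \<Longrightarrow> N \<subseteq> carrier M"
  by (simp add: graded_submodule_def additive_subgroup.a_subset)

text \<open>Makes a summand a graded module of its own, as needed to form products with it and to
  invert maps on it.\<close>

lemma gmod_gsub:
  assumes M: "gmod M Mg" and N: "gsub M Mg N"
  shows "gmod (M\<lparr>carrier := N\<rparr>) (\<lambda>\<gamma>. N \<inter> Mg \<gamma>)"
proof -
  interpret M: graded_module \<Gamma> R Rg M Mg by fact
  have N': "additive_subgroup N M" "\<And>x r. \<lbrakk>x \<in> N; r \<in> carrier R\<rbrakk> \<Longrightarrow> x \<cdot>\<^bsub>M\<^esub> r \<in> N"
    using N by (simp_all add: graded_submodule_def)
  have Rg: "Rg \<gamma> \<subseteq> carrier R" if "\<gamma> \<in> carrier \<Gamma>" for \<gamma>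
    using ring_direct_sum that by (simp add: internal_direct_sum_def additive_subgroup.a_subset)
  have sub: "x \<in> carrier M" if "x \<in> N" for x using gsub_subset[OF N] that by blast
  have "right_module R (M\<lparr>carrier := N\<rparr>)"
    by (intro right_module.intro R.ring_axioms right_module_axioms.intro
        abelian_group_additive_subgroup M.M.abelian_group_axioms)
      (simp_all add: N' sub M.rsmult_l_distr M.rsmult_r_distr M.rsmult_assoc M.rsmult_one)
  then show ?thesis
    using N Rg
    by (intro graded_module.intro graded_module_axioms.intro graded_ring_axioms)
      (auto simp: graded_submodule_def M.module_mult_degree subset_iff)
qed

lemma graded_hom_gsub_iff:
  assumes "gmod A Ag" "gsub M Mg N"
  shows "f \<in> ghom A Ag (M\<lparr>carrier := N\<rparr>) (\<lambda>\<gamma>. N \<inter> Mg \<gamma>) \<longleftrightarrow>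
    f \<in> ghom A Ag M Mg \<and> f ` carrier A \<subseteq> N"
  using gmod_degree(2)[OF assms(1)] gsub_subset[OF assms(2)]
  by (fastforce simp: graded_hom_def right_module_hom_def image_subset_iff)

lemma graded_hom_inclusion:
  "gsub M Mg N \<Longrightarrow> (\<lambda>x. x) \<in> ghom (M\<lparr>carrier := N\<rparr>) (\<lambda>\<gamma>. N \<inter> Mg \<gamma>) M Mg"
  by (rule graded_homI) (auto dest: gsub_subset)

text \<open>Components of \<open>x\<close> are mapped to components of \<open>f x\<close>, so
  homogeneous elements span the image; independence is inherited from \<open>M\<close>. Kernels and
  common complements are recognised as graded submodules by writing them as images.\<close>

lemma gsub_image:
  assumes A: "gmod A Ag" and M: "gmod M Mg" and f: "f \<in> ghom A Ag M Mg"
  shows "gsub M Mg (f ` carrier A)"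
proof -
  interpret f: abelian_group_hom A M f
    using A M f by (rule graded_hom_abelian_group_hom)
  let ?N = "f ` carrier A"
  let ?MN = "M\<lparr>carrier := ?N\<rparr>"
  have N: "additive_subgroup ?N M"
    using f.a_group_hom group_hom.img_is_subgroup by (fastforce intro: additive_subgroup.intro)
  interpret N: additive_subgroup ?N M by fact
  interpret MN: abelian_group ?MN
    using f.H.abelian_group_axioms N by (rule abelian_group_additive_subgroup)
  have sub: "additive_subgroup (?N \<inter> Mg \<gamma>) ?MN" if "\<gamma> \<in> carrier \<Gamma>" for \<gamma>
  proof -
    have "subgroup (?N \<inter> Mg \<gamma>) (add_monoid M)"
      using f.H.a_group N.a_subgroup gmod_degree(1)[OF M that]
      by (simp add: additive_subgroup_def group.subgroups_Inter_pair)
    then have "subgroup (?N \<inter> Mg \<gamma>) ((add_monoid M)\<lparr>carrier := ?N\<rparr>)"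
      by (rule group.subgroup_incl[OF f.H.a_group _ N.a_subgroup Int_lower1])
    then show ?thesis by (simp add: additive_subgroup_def)
  qed
  interpret fN: abelian_group_hom A ?MN f
    by (rule abelian_group_hom_intro[OF f.G.abelian_group_axioms MN.abelian_group_axioms]) auto
  \<comment> \<open>Sums in \<open>?MN\<close> and in \<open>M\<close> are formally different; the
    inclusion, being a homomorphism, identifies them.\<close>
  interpret incl: abelian_group_hom ?MN M "\<lambda>x. x"
    by (rule abelian_group_hom_intro[OF MN.abelian_group_axioms f.H.abelian_group_axioms]) auto
  have "internal_direct_sum ?MN (carrier \<Gamma>) (\<lambda>\<gamma>. ?N \<inter> Mg \<gamma>)"
    unfolding MN.internal_direct_sum_iff
  proof (intro conjI ballI allI impI)
    fix y assume "y \<in> carrier ?MN"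
    then obtain x where x: "x \<in> carrier A" "y = f x" by auto
    obtain c F where F: "finite F" "F \<subseteq> carrier \<Gamma>" and c: "c \<in> Pi F Ag" "c \<in> F \<rightarrow> carrier A"
      and eq: "x = finsum A c F"
      by (rule gmod_span[OF A x(1)])
    have "y = finsum ?MN (\<lambda>i. f (c i)) F" using fN.hom_finsum[OF c(2)] x(2) eq by simp
    moreover have "(\<lambda>i. f (c i)) \<in> (\<Pi> i\<in>F. ?N \<inter> Mg i)"
      using c F graded_homD(4)[OF f] by blast
    ultimately show "\<exists>c F. finite F \<and> F \<subseteq> carrier \<Gamma> \<and> c \<in> (\<Pi> i\<in>F. ?N \<inter> Mg i) \<and> y = finsum ?MN c F"
      using F by blast
  next
    fix c F i
    assume *: "finite F \<and> F \<subseteq> carrier \<Gamma> \<and> c \<in> (\<Pi> i\<in>F. ?N \<inter> Mg i) \<and> finsum ?MN c F = \<zero>\<^bsub>?MN\<^esub>"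
      and i: "i \<in> F"
    have "c \<in> F \<rightarrow> carrier ?MN" using * by auto
    then have "finsum M c F = \<zero>\<^bsub>M\<^esub>" using incl.hom_finsum[of c F] * by simp
    then show "c i = \<zero>\<^bsub>?MN\<^esub>" using gmod_indep[OF M, of F c i] * i by auto
  qed (rule sub)
  moreover have "x \<cdot>\<^bsub>M\<^esub> r \<in> ?N" if "x \<in> ?N" "r \<in> carrier R" for x r
    using that graded_homD(3)[OF f, symmetric] gmod_smult(1)[OF A] by auto
  ultimately show ?thesis using N by (simp add: graded_submodule_def)
qed

section \<open>Products of graded modules\<close>

lemma graded_hom_fst: "fst \<in> ghom (prod_module M N) (\<lambda>\<gamma>. Mg \<gamma> \<times> Ng \<gamma>) M Mg"
  and graded_hom_snd: "snd \<in> ghom (prod_module M N) (\<lambda>\<gamma>. Mg \<gamma> \<times> Ng \<gamma>) N Ng"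
  by (rule graded_homI; clarsimp)+

lemma graded_hom_Pair:
  assumes "f \<in> ghom L Lg M Mg" "g \<in> ghom L Lg N Ng"
  shows "(\<lambda>x. (f x, g x)) \<in> ghom L Lg (prod_module M N) (\<lambda>\<gamma>. Mg \<gamma> \<times> Ng \<gamma>)"
  by (rule graded_homI) (simp_all add: graded_homD[OF assms(1)] graded_homD[OF assms(2)])

text \<open>Spanning comes from the two injections and independence from the two projections, all of
  which commute with finite sums.\<close>

lemma gmod_prod_module:
  assumes M: "gmod M Mg" and N: "gmod N Ng"
  shows "gmod (prod_module M N) (\<lambda>\<gamma>. Mg \<gamma> \<times> Ng \<gamma>)"
proof -
  interpret M: graded_module \<Gamma> R Rg M Mg by fact
  interpret N: graded_module \<Gamma> R Rg N Ng by fact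
  let ?P = "prod_module M N" and ?Pg = "\<lambda>\<gamma>. Mg \<gamma> \<times> Ng \<gamma>"
  interpret P: abelian_group ?P
    using M.M.abelian_group_axioms N.M.abelian_group_axioms by (rule abelian_group_prod_module)
  have fst: "abelian_group_hom ?P M fst"
    by (rule abelian_group_hom_intro[OF P.abelian_group_axioms M.M.abelian_group_axioms]) auto
  have snd: "abelian_group_hom ?P N snd"
    by (rule abelian_group_hom_intro[OF P.abelian_group_axioms N.M.abelian_group_axioms]) auto
  have inl: "abelian_group_hom M ?P (\<lambda>x. (x, \<zero>\<^bsub>N\<^esub>))"
    by (rule abelian_group_hom_intro[OF M.M.abelian_group_axioms P.abelian_group_axioms]) auto
  have inr: "abelian_group_hom N ?P (\<lambda>x. (\<zero>\<^bsub>M\<^esub>, x))"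
    by (rule abelian_group_hom_intro[OF N.M.abelian_group_axioms P.abelian_group_axioms]) auto
  have sub: "additive_subgroup (?Pg \<gamma>) ?P" if "\<gamma> \<in> carrier \<Gamma>" for \<gamma>
  proof (intro additive_subgroup.intro subgroup.intro)
    fix x assume x: "x \<in> ?Pg \<gamma>"
    then have "fst x \<in> carrier M" "snd x \<in> carrier N"
      using gmod_degree(2)[OF M that] gmod_degree(2)[OF N that] by auto
    then have "\<ominus>\<^bsub>?P\<^esub> x = (\<ominus>\<^bsub>M\<^esub> fst x, \<ominus>\<^bsub>N\<^esub> snd x)"
      by (intro P.minus_equality) (auto simp: mem_Times_iff M.M.l_neg N.M.l_neg)
    then show "inv\<^bsub>add_monoid ?P\<^esub> x \<in> ?Pg \<gamma>"
      using x gmod_degree(5)[OF M that] gmod_degree(5)[OF N that] by (auto simp: a_inv_def)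
  qed (use gmod_degree[OF M that] gmod_degree[OF N that] in auto)
  have "internal_direct_sum ?P (carrier \<Gamma>) ?Pg"
    unfolding P.internal_direct_sum_iff
  proof (intro conjI ballI allI impI)
    fix z assume "z \<in> carrier ?P"
    then obtain x y where z: "z = (x, y)" "x \<in> carrier M" "y \<in> carrier N" by auto
    obtain c F where F: "finite F" "F \<subseteq> carrier \<Gamma>" and c: "c \<in> Pi F Mg" "c \<in> F \<rightarrow> carrier M"
      and x: "x = finsum M c F"
      by (rule gmod_span[OF M z(2)])
    obtain d E where E: "finite E" "E \<subseteq> carrier \<Gamma>" and d: "d \<in> Pi E Ng" "d \<in> E \<rightarrow> carrier N"
      and y: "y = finsum N d E"
      by (rule gmod_span[OF N z(3)])
    \<comment> \<open>The two decompositions are padded with zeros so that both run over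
      \<open>F \<union> E\<close>.\<close>
    define c' where "c' i = (if i \<in> F then c i else \<zero>\<^bsub>M\<^esub>)" for i
    define d' where "d' i = (if i \<in> E then d i else \<zero>\<^bsub>N\<^esub>)" for i
    have x': "x = finsum M c' (F \<union> E)" unfolding x
      by (rule M.M.add.finprod_mono_neutral_cong_left) (use F E c in \<open>auto simp: c'_def\<close>)
    have y': "y = finsum N d' (F \<union> E)" unfolding y
      by (rule N.M.add.finprod_mono_neutral_cong_left) (use F E d in \<open>auto simp: d'_def\<close>)
    have c': "c' \<in> F \<union> E \<rightarrow> carrier M" and d': "d' \<in> F \<union> E \<rightarrow> carrier N"
      using c d by (auto simp: c'_def d'_def)
    have "z = (x, \<zero>\<^bsub>N\<^esub>) \<oplus>\<^bsub>?P\<^esub> (\<zero>\<^bsub>M\<^esub>, y)" using z by simp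
    also have "\<dots> = finsum ?P (\<lambda>i. (c' i, \<zero>\<^bsub>N\<^esub>)) (F \<union> E) \<oplus>\<^bsub>?P\<^esub> finsum ?P (\<lambda>i. (\<zero>\<^bsub>M\<^esub>, d' i)) (F \<union> E)"
      using abelian_group_hom.hom_finsum[OF inl c'] abelian_group_hom.hom_finsum[OF inr d'] x' y' by (simp only:)
    also have "\<dots> = finsum ?P (\<lambda>i. (c' i, d' i)) (F \<union> E)"
      using c' d' by (subst P.finsum_addf[symmetric]) (auto simp: Pi_iff intro!: P.finsum_cong')
    finally have "z = finsum ?P (\<lambda>i. (c' i, d' i)) (F \<union> E)" .
    moreover have "(\<lambda>i. (c' i, d' i)) \<in> Pi (F \<union> E) ?Pg"
      using c d F E gmod_degree(3)[OF M] gmod_degree(3)[OF N] by (auto simp: c'_def d'_def Pi_iff subset_iff)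
    ultimately show "\<exists>c F. finite F \<and> F \<subseteq> carrier \<Gamma> \<and> c \<in> Pi F ?Pg \<and> z = finsum ?P c F"
      using F E by (intro exI[of _ "\<lambda>i. (c' i, d' i)"] exI[of _ "F \<union> E"]) simp
  next
    fix c F i
    assume *: "finite F \<and> F \<subseteq> carrier \<Gamma> \<and> c \<in> Pi F ?Pg \<and> finsum ?P c F = \<zero>\<^bsub>?P\<^esub>" and i: "i \<in> F"
    then have mem: "(\<lambda>i. fst (c i)) \<in> Pi F Mg" "(\<lambda>i. snd (c i)) \<in> Pi F Ng" by (auto simp: mem_Times_iff Pi_iff)
    have "c \<in> F \<rightarrow> carrier ?P"
    proof
      fix j assume "j \<in> F"
      then show "c j \<in> carrier ?P" using * sub additive_subgroup.a_subset by blast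
    qed
    then have "finsum M (\<lambda>i. fst (c i)) F = \<zero>\<^bsub>M\<^esub>" "finsum N (\<lambda>i. snd (c i)) F = \<zero>\<^bsub>N\<^esub>"
      using abelian_group_hom.hom_finsum[OF fst, of c F] abelian_group_hom.hom_finsum[OF snd, of c F] * by simp_all
    then have "fst (c i) = \<zero>\<^bsub>M\<^esub>" "snd (c i) = \<zero>\<^bsub>N\<^esub>"
      using gmod_indep[OF M _ _ mem(1)] gmod_indep[OF N _ _ mem(2)] * i by blast+
    then show "c i = \<zero>\<^bsub>?P\<^esub>" by (simp add: prod_eq_iff)
  qed (rule sub)
  moreover have "right_module R ?P"
    by (intro right_module.intro R.ring_axioms right_module_axioms.intro P.abelian_group_axioms)
      (auto simp: M.rsmult_closed N.rsmult_closed M.rsmult_l_distr N.rsmult_l_distr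
        M.rsmult_r_distr N.rsmult_r_distr M.rsmult_assoc N.rsmult_assoc M.rsmult_one N.rsmult_one)
  ultimately show ?thesis
    by (intro graded_module.intro graded_module_axioms.intro graded_ring_axioms)
      (auto simp: M.module_mult_degree N.module_mult_degree)
qed

section \<open>Complements, kernels and retractions\<close>

lemma mem_set_add: "x \<in> H <+>\<^bsub>G\<^esub> K \<longleftrightarrow> (\<exists>h\<in>H. \<exists>k\<in>K. x = h \<oplus>\<^bsub>G\<^esub> k)"
  by (simp add: set_add_def set_mult_def)

lemma direct_sum_of_commute:
  assumes M: "gmod M Mg" and NK: "N \<subseteq> carrier M" "K \<subseteq> carrier M"
  shows "direct_sum_of M N K \<longleftrightarrow> direct_sum_of M K N"
proof -
  interpret M: abelian_group M using M by (rule gmod_abelian_group)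
  have "N <+>\<^bsub>M\<^esub> K = K <+>\<^bsub>M\<^esub> N"
    using NK M.a_comm by (auto simp: set_eq_iff mem_set_add subset_iff) metis+
  then show ?thesis by (simp add: direct_sum_of_def Int_commute)
qed

text \<open>Injectivity of \<open>p\<close> on \<open>C\<close> means that \<open>C\<close> meets
  the kernel only in zero; as \<open>p\<close> is onto, surjectivity of its restriction to
  \<open>C\<close> means that the kernel and \<open>C\<close> span \<open>M\<close>. The search for
  a common complement thus becomes a question about bijectivity.\<close>

lemma direct_sum_of_kernel_iff:
  assumes M: "gmod M Mg" and N: "gmod N Ng" and p: "p \<in> ghom M Mg N Ng"
    and surj: "p ` carrier M = carrier N" and C: "gsub M Mg C"
  shows "direct_sum_of M {x \<in> carrier M. p x = \<zero>\<^bsub>N\<^esub>} C \<longleftrightarrow> bij_betw p C (carrier N)"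
proof -
  interpret M: abelian_group M using M by (rule gmod_abelian_group)
  interpret N: abelian_group N using N by (rule gmod_abelian_group)
  interpret C: additive_subgroup C M using C by (simp add: graded_submodule_def)
  let ?K = "{x \<in> carrier M. p x = \<zero>\<^bsub>N\<^esub>}"
  note p_simps = graded_homD[OF p] graded_hom_zero_minus[OF M N p]
  have sub: "x \<in> carrier M" if "x \<in> C" for x using C.a_subset that by blast
  show ?thesis
  proof
    assume ds: "direct_sum_of M ?K C"
    have "inj_on p C"
    proof
      fix x y assume xy: "x \<in> C" "y \<in> C" "p x = p y"
      then have "x \<ominus>\<^bsub>M\<^esub> y \<in> ?K \<inter> C"
        by (simp add: sub p_simps N.minus_eq_zero_iff) (simp add: M.minus_eq)
      then have "x \<ominus>\<^bsub>M\<^esub> y = \<zero>\<^bsub>M\<^esub>" using ds unfolding direct_sum_of_def by blast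
      then show "x = y" using xy by (simp add: M.minus_eq_zero_iff sub)
    qed
    moreover have "y \<in> p ` C" if y: "y \<in> carrier N" for y
    proof -
      obtain x where x: "x \<in> carrier M" "y = p x" using y surj by (metis imageE)
      have "x \<in> ?K <+>\<^bsub>M\<^esub> C" using ds x(1) by (simp add: direct_sum_of_def)
      then obtain k c where k: "k \<in> ?K" and c: "c \<in> C" and eq: "x = k \<oplus>\<^bsub>M\<^esub> c"
        unfolding mem_set_add by blast
      have "y = p k \<oplus>\<^bsub>N\<^esub> p c" using k sub[OF c] by (simp add: x(2) eq p_simps(2))
      also have "\<dots> = p c" using k p_simps(1)[OF sub[OF c]] by simp
      finally show ?thesis using c by blast
    qed
    ultimately show "bij_betw p C (carrier N)"
      using sub p_simps(1) by (auto simp: bij_betw_def)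
  next
    assume bij: "bij_betw p C (carrier N)"
    have "x \<in> ?K <+>\<^bsub>M\<^esub> C" if x: "x \<in> carrier M" for x
    proof -
      \<comment> \<open>Correcting \<open>x\<close> by the element of \<open>C\<close> with the same
        image leaves an element of the kernel.\<close>
      obtain c where c: "c \<in> C" "p c = p x"
        using bij p_simps(1)[OF x] by (metis bij_betw_imp_surj_on imageE)
      have "x \<ominus>\<^bsub>M\<^esub> c \<in> ?K" using c x by (simp add: p_simps sub N.minus_eq_zero_iff)
      moreover have "x = (x \<ominus>\<^bsub>M\<^esub> c) \<oplus>\<^bsub>M\<^esub> c"
        using c x sub by (simp add: M.minus_eq M.a_assoc M.l_neg)
      ultimately show ?thesis using c(1) unfolding mem_set_add by blast
    qed
    then have "?K <+>\<^bsub>M\<^esub> C = carrier M" by (auto simp: mem_set_add sub)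
    moreover have "x = \<zero>\<^bsub>M\<^esub>" if "x \<in> ?K \<inter> C" for x
      using that bij_betw_imp_inj_on[OF bij] p_simps(5) C.zero_closed
      by (metis (mono_tags, lifting) IntE inj_onD mem_Collect_eq)
    ultimately show "direct_sum_of M ?K C"
      by (auto simp: direct_sum_of_def p_simps)
  qed
qed

text \<open>Take for \<open>i\<close> the given isomorphism onto \<open>N\<close>, followed by the
  inclusion. The map \<open>\<sigma>\<close> that sends \<open>(a, k)\<close> to
  \<open>i a + k\<close> is a bijective graded map from \<open>A \<times> K\<close> to
  \<open>M\<close>, and \<open>p\<close> is the first coordinate of its inverse.\<close>

lemma summand_retraction:
  assumes M: "gmod M Mg" and A: "gmod A Ag" and N: "gsub M Mg N" and K: "gsub M Mg K"
    and ds: "direct_sum_of M N K"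
    and iso: "graded_iso \<Gamma> R A Ag (M\<lparr>carrier := N\<rparr>) (\<lambda>\<gamma>. N \<inter> Mg \<gamma>)"
  obtains i p where "i \<in> ghom A Ag M Mg" "p \<in> ghom M Mg A Ag"
    "\<And>a. a \<in> carrier A \<Longrightarrow> p (i a) = a" "K = {x \<in> carrier M. p x = \<zero>\<^bsub>A\<^esub>}"
proof -
  interpret M: abelian_group M using M by (rule gmod_abelian_group)
  interpret A: abelian_group A using A by (rule gmod_abelian_group)
  interpret N: additive_subgroup N M using N by (simp add: graded_submodule_def)
  interpret K: additive_subgroup K M using K by (simp add: graded_submodule_def)
  let ?MK = "M\<lparr>carrier := K\<rparr>" and ?Kg = "\<lambda>\<gamma>. K \<inter> Mg \<gamma>"
  have subN: "x \<in> carrier M" if "x \<in> N" for x using N.a_subset that by blast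
  have subK: "x \<in> carrier M" if "x \<in> K" for x using K.a_subset that by blast
  obtain i where "i \<in> ghom A Ag (M\<lparr>carrier := N\<rparr>) (\<lambda>\<gamma>. N \<inter> Mg \<gamma>)" and bij_i: "bij_betw i (carrier A) N"
    using iso by (auto simp: graded_iso_def graded_hom_def)
  then have i: "i \<in> ghom A Ag M Mg" by (simp add: graded_hom_gsub_iff[OF A N])
  define \<sigma> where "\<sigma> x = i (fst x) \<oplus>\<^bsub>M\<^esub> snd x" for x
  let ?P = "prod_module A ?MK" and ?Pg = "\<lambda>\<gamma>. Ag \<gamma> \<times> ?Kg \<gamma>"
  have P: "gmod ?P ?Pg" using A gmod_gsub[OF M K] by (rule gmod_prod_module)
  have iN: "i a \<in> N" if "a \<in> carrier A" for a using bij_betwE[OF bij_i] that by blast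
  have \<sigma>: "\<sigma> \<in> ghom ?P ?Pg M Mg"
    unfolding \<sigma>_def
    by (intro graded_hom_add[OF M] graded_hom_comp[OF i graded_hom_fst]
        graded_hom_comp[OF graded_hom_inclusion[OF K] graded_hom_snd])
  have inj: "\<sigma> x = \<sigma> y \<Longrightarrow> x = y" if carr: "x \<in> carrier ?P" "y \<in> carrier ?P" for x y
  proof -
    assume eq: "\<sigma> x = \<sigma> y"
    obtain a k b l where xy: "x = (a, k)" "y = (b, l)" "a \<in> carrier A" "b \<in> carrier A" "k \<in> K" "l \<in> K"
      using carr by auto
    have eq: "i a \<oplus>\<^bsub>M\<^esub> k = i b \<oplus>\<^bsub>M\<^esub> l" using eq xy by (simp add: \<sigma>_def)
    note carr = iN[OF xy(3)] iN[OF xy(4)] xy(5,6)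
    note carrM = carr(1,2)[THEN subN] carr(3,4)[THEN subK]
    \<comment> \<open>The left side lies in \<open>N\<close> and the right side in \<open>K\<close>,
      so both vanish.\<close>
    have "i a \<ominus>\<^bsub>M\<^esub> i b = l \<ominus>\<^bsub>M\<^esub> k"
      using eq carrM by (intro M.minus_eq_minusI)
    moreover have "i a \<ominus>\<^bsub>M\<^esub> i b \<in> N" "l \<ominus>\<^bsub>M\<^esub> k \<in> K" using carr by (simp_all add: M.minus_eq)
    ultimately have "i a \<ominus>\<^bsub>M\<^esub> i b = \<zero>\<^bsub>M\<^esub>" "l \<ominus>\<^bsub>M\<^esub> k = \<zero>\<^bsub>M\<^esub>"
      using ds unfolding direct_sum_of_def by auto
    then have "i a = i b" "l = k" using carrM by (simp_all add: M.minus_eq_zero_iff)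
    then show "x = y" using xy bij_betw_imp_inj_on[OF bij_i] by (auto dest: inj_onD)
  qed
  have surj: "y \<in> \<sigma> ` carrier ?P" if "y \<in> carrier M" for y
  proof -
    have "y \<in> N <+>\<^bsub>M\<^esub> K" using ds that by (simp add: direct_sum_of_def)
    then obtain n k where nk: "n \<in> N" "k \<in> K" "y = n \<oplus>\<^bsub>M\<^esub> k" unfolding mem_set_add by blast
    obtain a where "a \<in> carrier A" "n = i a"
      using nk(1) bij_betw_imp_surj_on[OF bij_i] by blast
    then show ?thesis using nk by (intro image_eqI[of _ _ "(a, k)"]) (auto simp: \<sigma>_def)
  qed
  have bij: "bij_betw \<sigma> (carrier ?P) (carrier M)"
    unfolding bij_betw_def using inj surj graded_homD(1)[OF \<sigma>] by (auto intro!: inj_onI)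
  let ?g = "inv_into (carrier ?P) \<sigma>"
  have g: "?g (\<sigma> x) = x" if "x \<in> carrier ?P" for x
    using bij_betw_imp_inj_on[OF bij] that by (rule inv_into_f_f)
  have p: "(\<lambda>x. fst (?g x)) \<in> ghom M Mg A Ag"
    by (rule graded_hom_comp[OF graded_hom_fst graded_hom_inverse[OF P M \<sigma> bij]])
  have "i \<zero>\<^bsub>A\<^esub> = \<zero>\<^bsub>M\<^esub>" using graded_hom_zero_minus(1)[OF A M i] .
  \<comment> \<open>An element \<open>k\<close> of \<open>K\<close> comes from the pair
    \<open>(0, k)\<close>; hence \<open>K\<close> is exactly where the first coordinate of the
    inverse vanishes.\<close>
  then have \<sigma>0: "\<sigma> (\<zero>\<^bsub>A\<^esub>, k) = k" if "k \<in> K" for k using that subK by (simp add: \<sigma>_def)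
  have "fst (?g (i a)) = a" if "a \<in> carrier A" for a
  proof -
    have "\<sigma> (a, \<zero>\<^bsub>M\<^esub>) = i a" using subN[OF iN[OF that]] by (simp add: \<sigma>_def)
    then show ?thesis using g[of "(a, \<zero>\<^bsub>M\<^esub>)"] that by simp
  qed
  moreover have "K = {x \<in> carrier M. fst (?g x) = \<zero>\<^bsub>A\<^esub>}"
  proof (intro Set.set_eqI iffI)
    fix k assume "k \<in> K"
    then show "k \<in> {x \<in> carrier M. fst (?g x) = \<zero>\<^bsub>A\<^esub>}"
      using g[of "(\<zero>\<^bsub>A\<^esub>, k)"] \<sigma>0 subK by simp
  next
    fix x assume x: "x \<in> {x \<in> carrier M. fst (?g x) = \<zero>\<^bsub>A\<^esub>}"
    then obtain y where y: "y \<in> carrier ?P" "x = \<sigma> y" using surj by blast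
    then have "fst y = \<zero>\<^bsub>A\<^esub>" "snd y \<in> K" using x g by auto
    then show "x \<in> K" using \<sigma>0 y by (metis prod.collapse)
  qed
  ultimately show thesis using that[OF i p] by blast
qed

text \<open>The kernel \<open>K\<close> is the image of the graded map \<open>1 - i p\<close>, hence
  a graded submodule. On the image of \<open>i\<close> the map \<open>p\<close> is inverted by
  \<open>i\<close>, so this image is a complement of \<open>K\<close>.\<close>

lemma retraction_summand:
  assumes M: "gmod M Mg" and A: "gmod A Ag" and i: "i \<in> ghom A Ag M Mg" and p: "p \<in> ghom M Mg A Ag"
    and pi: "\<And>a. a \<in> carrier A \<Longrightarrow> p (i a) = a"
  defines "K \<equiv> {x \<in> carrier M. p x = \<zero>\<^bsub>A\<^esub>}"
  shows "gsub M Mg (i ` carrier A)" "gsub M Mg K" "direct_sum_of M (i ` carrier A) K"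
    "graded_iso \<Gamma> R A Ag (M\<lparr>carrier := i ` carrier A\<rparr>) (\<lambda>\<gamma>. i ` carrier A \<inter> Mg \<gamma>)"
proof -
  interpret M: abelian_group M using M by (rule gmod_abelian_group)
  interpret A: abelian_group A using A by (rule gmod_abelian_group)
  let ?N = "i ` carrier A"
  note i_simps = graded_homD[OF i] and p_simps = graded_homD[OF p]
  show N: "gsub M Mg ?N" using A M i by (rule gsub_image)
  have q: "(\<lambda>x. x \<ominus>\<^bsub>M\<^esub> i (p x)) \<in> ghom M Mg M Mg"
    by (rule graded_hom_minus[OF M graded_hom_id graded_hom_comp[OF i p]])
  \<comment> \<open>\<open>1 - i p\<close> fixes every element of the kernel, and \<open>p\<close>
    kills its values because \<open>p i = 1\<close>.\<close>
  have "K = (\<lambda>x. x \<ominus>\<^bsub>M\<^esub> i (p x)) ` carrier M"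
  proof (intro Set.set_eqI iffI)
    fix x assume "x \<in> K"
    then show "x \<in> (\<lambda>x. x \<ominus>\<^bsub>M\<^esub> i (p x)) ` carrier M"
      by (intro image_eqI[of _ _ x]) (simp_all add: K_def graded_hom_zero_minus(1)[OF A M i] M.minus_eq)
  next
    fix x assume "x \<in> (\<lambda>x. x \<ominus>\<^bsub>M\<^esub> i (p x)) ` carrier M"
    then obtain y where y: "y \<in> carrier M" "x = y \<ominus>\<^bsub>M\<^esub> i (p y)" by blast
    then show "x \<in> K"
      by (simp add: K_def graded_hom_zero_minus[OF M A p] i_simps p_simps pi A.minus_eq_zero_iff)
  qed
  then show "gsub M Mg K" using gsub_image[OF M M q] by simp
  have bij: "bij_betw p ?N (carrier A)"
    by (rule bij_betw_byWitness[of _ i]) (auto simp: pi)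
  have "p ` carrier M = carrier A"
    using i_simps(1) p_simps(1) pi by (auto intro!: image_eqI[of _ p "i _"])
  then have "direct_sum_of M K ?N"
    unfolding K_def using bij direct_sum_of_kernel_iff[OF M A p _ N] by simp
  then show "direct_sum_of M ?N K"
    using direct_sum_of_commute[OF M, of K ?N] gsub_subset[OF N] by (auto simp: K_def)
  have "inj_on i (carrier A)" using pi by (rule inj_on_inverseI)
  \<comment> \<open>If \<open>i a\<close> has degree \<open>\<gamma>\<close>, then so has
    \<open>a = p (i a)\<close>, since \<open>p\<close> respects degrees.\<close>
  moreover have "i ` Ag \<gamma> = ?N \<inter> Mg \<gamma>" if \<gamma>: "\<gamma> \<in> carrier \<Gamma>" for \<gamma>
  proof (intro Set.set_eqI iffI)
    fix x assume "x \<in> i ` Ag \<gamma>"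
    then show "x \<in> ?N \<inter> Mg \<gamma>" using i_simps(4)[OF \<gamma>] gmod_degree(2)[OF A \<gamma>] by blast
  next
    fix x assume x: "x \<in> ?N \<inter> Mg \<gamma>"
    then obtain a where a: "a \<in> carrier A" "x = i a" by blast
    then have "a \<in> Ag \<gamma>" using x p_simps(4)[OF \<gamma>, of x] pi by simp
    then show "x \<in> i ` Ag \<gamma>" using a by blast
  qed
  moreover have "i \<in> right_module_hom R A (M\<lparr>carrier := ?N\<rparr>)"
    using i by (auto simp: graded_hom_def right_module_hom_def)
  ultimately show "graded_iso \<Gamma> R A Ag (M\<lparr>carrier := ?N\<rparr>) (\<lambda>\<gamma>. ?N \<inter> Mg \<gamma>)"
    unfolding graded_iso_def by (intro bexI[of _ i]) (auto simp: bij_betw_def)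
qed

section \<open>Stable range 1 of the graded endomorphism ring\<close>

lemma graded_End_ring_simps:
  "f \<in> carrier (graded_End_ring \<Gamma> R A Ag) \<longleftrightarrow> f \<in> ghom A Ag A Ag \<and> f \<in> extensional (carrier A)"
  "f \<otimes>\<^bsub>graded_End_ring \<Gamma> R A Ag\<^esub> g = (\<lambda>z\<in>carrier A. f (g z))"
  "f \<oplus>\<^bsub>graded_End_ring \<Gamma> R A Ag\<^esub> g = (\<lambda>z\<in>carrier A. f z \<oplus>\<^bsub>A\<^esub> g z)"
  by (auto simp: graded_End_ring_def End_ring_def graded_hom_def compose_def)

lemma restrict_graded_hom:
  assumes "gmod A Ag" "f \<in> ghom A Ag A Ag"
  shows "restrict f (carrier A) \<in> carrier (graded_End_ring \<Gamma> R A Ag)"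
  using graded_hom_cong[OF assms, of "restrict f (carrier A)"] by (simp add: graded_End_ring_simps)

text \<open>The right ideal is the whole ring as soon as it contains the identity
  \<open>v w\<close>, because then \<open>t = v (w t)\<close>. Taking \<open>w\<close> among all
  graded maps keeps extensionality out of later arguments.\<close>

lemma graded_End_ring_right_ideal_iff:
  fixes A :: "('r, 'a) right_module" and Ag :: "'g \<Rightarrow> 'a set"
  defines "T \<equiv> graded_End_ring \<Gamma> R A Ag"
  assumes A: "gmod A Ag" and v: "v \<in> carrier T"
  shows "v <#\<^bsub>T\<^esub> carrier T = carrier T \<longleftrightarrow> (\<exists>w\<in>ghom A Ag A Ag. \<forall>z\<in>carrier A. v (w z) = z)"
proof
  assume eq: "v <#\<^bsub>T\<^esub> carrier T = carrier T"
  have "(\<lambda>z\<in>carrier A. z) \<in> carrier T"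
    unfolding T_def by (rule restrict_graded_hom[OF A graded_hom_id])
  then obtain w where w: "w \<in> carrier T" "(\<lambda>z\<in>carrier A. z) = v \<otimes>\<^bsub>T\<^esub> w"
    using eq unfolding l_coset_def by blast
  have "v (w z) = z" if "z \<in> carrier A" for z
    using fun_cong[OF w(2), of z] that by (simp add: T_def graded_End_ring_simps)
  then show "\<exists>w\<in>ghom A Ag A Ag. \<forall>z\<in>carrier A. v (w z) = z"
    using w(1) by (auto simp: T_def graded_End_ring_simps)
next
  assume "\<exists>w\<in>ghom A Ag A Ag. \<forall>z\<in>carrier A. v (w z) = z"
  then obtain w where w: "w \<in> ghom A Ag A Ag" and vw: "\<And>z. z \<in> carrier A \<Longrightarrow> v (w z) = z"
    by blast
  have v': "v \<in> ghom A Ag A Ag" using v by (simp add: T_def graded_End_ring_simps)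
  have "v \<otimes>\<^bsub>T\<^esub> t \<in> carrier T" if "t \<in> carrier T" for t
    using that restrict_graded_hom[OF A graded_hom_comp[OF v', of t]]
    by (simp add: T_def graded_End_ring_simps)
  moreover have "t \<in> v <#\<^bsub>T\<^esub> carrier T" if "t \<in> carrier T" for t
  proof -
    have t: "t \<in> ghom A Ag A Ag" "t \<in> extensional (carrier A)"
      using that by (simp_all add: T_def graded_End_ring_simps)
    have "restrict (\<lambda>z. w (t z)) (carrier A) \<in> carrier T"
      unfolding T_def by (rule restrict_graded_hom[OF A graded_hom_comp[OF w t(1)]])
    moreover have "t = v \<otimes>\<^bsub>T\<^esub> restrict (\<lambda>z. w (t z)) (carrier A)"
      using t(2) by (intro extensionalityI[of _ "carrier A"])
        (simp_all add: T_def graded_End_ring_simps vw graded_homD(1)[OF t(1)])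
    ultimately show ?thesis unfolding l_coset_def by blast
  qed
  ultimately show "v <#\<^bsub>T\<^esub> carrier T = carrier T" by (auto simp: l_coset_def)
qed

text \<open>Again only the identity has to be reached: from \<open>x a + y b = 1\<close> every
  \<open>t\<close> is obtained as \<open>x (a t) + y (b t)\<close>.\<close>

lemma graded_End_ring_two_generators_iff:
  fixes A :: "('r, 'a) right_module" and Ag :: "'g \<Rightarrow> 'a set"
  defines "T \<equiv> graded_End_ring \<Gamma> R A Ag"
  assumes A: "gmod A Ag" and x: "x \<in> carrier T" and y: "y \<in> carrier T"
  shows "(x <#\<^bsub>T\<^esub> carrier T) <+>\<^bsub>T\<^esub> (y <#\<^bsub>T\<^esub> carrier T) = carrier T \<longleftrightarrow>
    (\<exists>a\<in>ghom A Ag A Ag. \<exists>b\<in>ghom A Ag A Ag. \<forall>z\<in>carrier A. x (a z) \<oplus>\<^bsub>A\<^esub> y (b z) = z)"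
    (is "?I = _ \<longleftrightarrow> ?rhs")
proof -
  have xy: "x \<in> ghom A Ag A Ag" "y \<in> ghom A Ag A Ag"
    using x y by (simp_all add: T_def graded_End_ring_simps)
  have memI: "t \<in> ?I \<longleftrightarrow> (\<exists>a\<in>carrier T. \<exists>b\<in>carrier T. t = (x \<otimes>\<^bsub>T\<^esub> a) \<oplus>\<^bsub>T\<^esub> (y \<otimes>\<^bsub>T\<^esub> b))" for t
    by (auto simp: mem_set_add l_coset_def)
  show ?thesis
  proof
    assume eq: "?I = carrier T"
    have "(\<lambda>z\<in>carrier A. z) \<in> carrier T"
      unfolding T_def by (rule restrict_graded_hom[OF A graded_hom_id])
    then have "(\<lambda>z\<in>carrier A. z) \<in> ?I" by (simp only: eq)
    then obtain a b where ab: "a \<in> carrier T" "b \<in> carrier T"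
      and one: "(\<lambda>z\<in>carrier A. z) = (x \<otimes>\<^bsub>T\<^esub> a) \<oplus>\<^bsub>T\<^esub> (y \<otimes>\<^bsub>T\<^esub> b)"
      unfolding memI by blast
    have "x (a z) \<oplus>\<^bsub>A\<^esub> y (b z) = z" if "z \<in> carrier A" for z
      using fun_cong[OF one, of z] that by (simp add: T_def graded_End_ring_simps)
    then show ?rhs
      using ab by (auto simp: T_def graded_End_ring_simps)
  next
    assume ?rhs
    then obtain a b where ab: "a \<in> ghom A Ag A Ag" "b \<in> ghom A Ag A Ag"
      and one: "\<And>z. z \<in> carrier A \<Longrightarrow> x (a z) \<oplus>\<^bsub>A\<^esub> y (b z) = z"
      by blast
    have "(x \<otimes>\<^bsub>T\<^esub> s) \<oplus>\<^bsub>T\<^esub> (y \<otimes>\<^bsub>T\<^esub> t) \<in> carrier T" if "s \<in> carrier T" "t \<in> carrier T" for s t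
    proof -
      have st: "s \<in> ghom A Ag A Ag" "t \<in> ghom A Ag A Ag"
        using that by (simp_all add: T_def graded_End_ring_simps)
      have "restrict (\<lambda>z. x (s z) \<oplus>\<^bsub>A\<^esub> y (t z)) (carrier A) \<in> carrier T"
        unfolding T_def
        by (rule restrict_graded_hom[OF A graded_hom_add[OF A
              graded_hom_comp[OF xy(1) st(1)] graded_hom_comp[OF xy(2) st(2)]]])
      then show ?thesis by (simp add: T_def graded_End_ring_simps cong: restrict_cong)
    qed
    moreover have "t \<in> ?I" if "t \<in> carrier T" for t
    proof -
      have t: "t \<in> ghom A Ag A Ag" "t \<in> extensional (carrier A)"
        using that by (simp_all add: T_def graded_End_ring_simps)
      have "restrict (\<lambda>z. a (t z)) (carrier A) \<in> carrier T" "restrict (\<lambda>z. b (t z)) (carrier A) \<in> carrier T"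
        unfolding T_def using ab[THEN graded_hom_comp, OF t(1)] by (simp_all only: restrict_graded_hom[OF A])
      moreover have "t = (x \<otimes>\<^bsub>T\<^esub> restrict (\<lambda>z. a (t z)) (carrier A)) \<oplus>\<^bsub>T\<^esub>
          (y \<otimes>\<^bsub>T\<^esub> restrict (\<lambda>z. b (t z)) (carrier A))"
        using t(2) by (intro extensionalityI[of _ "carrier A"])
          (simp_all add: T_def graded_End_ring_simps one graded_homD(1)[OF t(1)])
      ultimately show ?thesis unfolding memI by blast
    qed
    ultimately show "?I = carrier T" by (auto simp: memI)
  qed
qed

text \<open>
  The bijectivity on the right-hand side contains the fact that a ring of stable range 1 is
  Dedekind-finite: if \<open>v w = 1\<close>, then \<open>w v + (1 - w v) = 1\<close> yields a right invertible
  \<open>t = w + (1 - w v) u\<close>, and \<open>v t = 1\<close>.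
\<close>

lemma stable_range_one_graded_End_ring_iff:
  assumes A: "gmod A Ag"
  shows "stable_range_one (graded_End_ring \<Gamma> R A Ag) \<longleftrightarrow>
    (\<forall>x\<in>ghom A Ag A Ag. \<forall>y\<in>ghom A Ag A Ag. \<forall>a\<in>ghom A Ag A Ag. \<forall>b\<in>ghom A Ag A Ag.
      (\<forall>z\<in>carrier A. x (a z) \<oplus>\<^bsub>A\<^esub> y (b z) = z) \<longrightarrow>
      (\<exists>u\<in>ghom A Ag A Ag. bij_betw (\<lambda>z. x z \<oplus>\<^bsub>A\<^esub> y (u z)) (carrier A) (carrier A)))"
    (is "stable_range_one ?T \<longleftrightarrow> ?unit")
proof -
  interpret A: abelian_group A using A by (rule gmod_abelian_group)
  let ?E = "ghom A Ag A Ag"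
  note T_simps = graded_End_ring_simps
  show ?thesis
  proof
    assume sr: "stable_range_one ?T"
    \<comment> \<open>Stable range 1 in terms of maps: \<open>x + y u\<close> has a right inverse
      \<open>w\<close>. It is applied first to the given pair, and then to the right inverse found
      there and the map \<open>e\<close> below.\<close>
    have right_inverse: "\<exists>u\<in>?E. \<exists>w\<in>?E. \<forall>z\<in>carrier A. x (w z) \<oplus>\<^bsub>A\<^esub> y (u (w z)) = z"
      if x: "x \<in> ?E" and y: "y \<in> ?E" and ab: "a \<in> ?E" "b \<in> ?E"
        and one: "\<And>z. z \<in> carrier A \<Longrightarrow> x (a z) \<oplus>\<^bsub>A\<^esub> y (b z) = z" for x y a b
    proof -
      let ?x = "restrict x (carrier A)" and ?y = "restrict y (carrier A)"
      have T: "?x \<in> carrier ?T" "?y \<in> carrier ?T" using A x y by (auto intro: restrict_graded_hom)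
      have "\<forall>z\<in>carrier A. ?x (a z) \<oplus>\<^bsub>A\<^esub> ?y (b z) = z"
        using one ab by (simp add: graded_homD(1))
      then have "(?x <#\<^bsub>?T\<^esub> carrier ?T) <+>\<^bsub>?T\<^esub> (?y <#\<^bsub>?T\<^esub> carrier ?T) = carrier ?T"
        using ab by (intro graded_End_ring_two_generators_iff[OF A T, THEN iffD2]) blast
      from sr[unfolded stable_range_one_def, rule_format, OF T this]
      obtain u where u: "u \<in> carrier ?T"
        and eq: "(?x \<oplus>\<^bsub>?T\<^esub> ?y \<otimes>\<^bsub>?T\<^esub> u) <#\<^bsub>?T\<^esub> carrier ?T = carrier ?T"
        by blast
      have u': "u \<in> ?E" using u by (simp add: T_simps)
      have v: "?x \<oplus>\<^bsub>?T\<^esub> ?y \<otimes>\<^bsub>?T\<^esub> u = (\<lambda>z\<in>carrier A. x z \<oplus>\<^bsub>A\<^esub> y (u z))"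
        by (auto simp: T_simps graded_homD(1)[OF u'] restrict_def)
      have "(\<lambda>z\<in>carrier A. x z \<oplus>\<^bsub>A\<^esub> y (u z)) \<in> carrier ?T"
        by (intro restrict_graded_hom[OF A] graded_hom_add[OF A] graded_hom_comp[OF y u'] x)
      from graded_End_ring_right_ideal_iff[OF A this]
      obtain w where "w \<in> ?E" "\<forall>z\<in>carrier A. (\<lambda>z\<in>carrier A. x z \<oplus>\<^bsub>A\<^esub> y (u z)) (w z) = z"
        using eq v by auto
      then show ?thesis using u' by (intro bexI[of _ u] bexI[of _ w]) (auto simp: graded_homD(1))
    qed
    show ?unit
    proof (intro ballI impI)
      fix x y a b assume xyab: "x \<in> ?E" "y \<in> ?E" "a \<in> ?E" "b \<in> ?E"
        and "\<forall>z\<in>carrier A. x (a z) \<oplus>\<^bsub>A\<^esub> y (b z) = z"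
      then obtain u w where u: "u \<in> ?E" and w: "w \<in> ?E"
        and vw: "\<And>z. z \<in> carrier A \<Longrightarrow> x (w z) \<oplus>\<^bsub>A\<^esub> y (u (w z)) = z"
        using right_inverse[of x y a b] by blast
      define v where "v z = x z \<oplus>\<^bsub>A\<^esub> y (u z)" for z
      have v: "v \<in> ?E" unfolding v_def by (intro graded_hom_add[OF A] graded_hom_comp[OF xyab(2) u] xyab(1))
      have vw: "v (w z) = z" if "z \<in> carrier A" for z using vw[OF that] by (simp add: v_def)
      define e where "e z = z \<ominus>\<^bsub>A\<^esub> w (v z)" for z
      have e: "e \<in> ?E" unfolding e_def by (intro graded_hom_minus[OF A] graded_hom_comp[OF w v] graded_hom_id)
      note closed = graded_homD(1)[OF v] graded_homD(1)[OF w] graded_homD(1)[OF e]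
      have "w (v z) \<oplus>\<^bsub>A\<^esub> e z = z" if "z \<in> carrier A" for z
        using that closed(1,2) by (simp add: e_def A.minus_eq A.a_lcomm[of "w (v z)"] A.r_neg)
      \<comment> \<open>Now \<open>s\<close> takes the role of \<open>u\<close>, and
        \<open>r\<close> is a right inverse of \<open>w + e s\<close>.\<close>
      then obtain s r where s: "s \<in> ?E" and r: "r \<in> ?E"
        and tr: "\<And>z. z \<in> carrier A \<Longrightarrow> w (r z) \<oplus>\<^bsub>A\<^esub> e (s (r z)) = z"
        using right_inverse[OF w e v graded_hom_id] by blast
      have ve: "v (e q) = \<zero>\<^bsub>A\<^esub>" if "q \<in> carrier A" for q
        using that closed(1,2)
        by (simp add: e_def graded_hom_zero_minus(2)[OF A A v] vw A.minus_eq_zero_iff)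
      have vt: "v (w z \<oplus>\<^bsub>A\<^esub> e q) = z" if "z \<in> carrier A" "q \<in> carrier A" for z q
        using that closed by (simp add: graded_homD(2)[OF v] vw ve)
      \<comment> \<open>Apply \<open>v\<close> to \<open>(w + e s) r = 1\<close>: since
        \<open>v (w + e s) = 1\<close>, this gives \<open>r = v\<close>. Hence
        \<open>w + e s\<close> is a two-sided inverse of \<open>v\<close>.\<close>
      have "v z = r z" if "z \<in> carrier A" for z
        using that tr[OF that] vt[of "r z" "s (r z)"] graded_homD(1)[OF r] graded_homD(1)[OF s] by simp
      then have "w (v z) \<oplus>\<^bsub>A\<^esub> e (s (v z)) = z" if "z \<in> carrier A" for z
        using that tr by simp
      then have "bij_betw v (carrier A) (carrier A)"
        using vw closed graded_homD(1)[OF s]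
        by (intro bij_betw_byWitness[of _ "\<lambda>z. w z \<oplus>\<^bsub>A\<^esub> e (s z)"])
          (auto simp: vt)
      then show "\<exists>u\<in>?E. bij_betw (\<lambda>z. x z \<oplus>\<^bsub>A\<^esub> y (u z)) (carrier A) (carrier A)"
        using u unfolding v_def by blast
    qed
  next
    assume unit: ?unit
    show "stable_range_one ?T"
      unfolding stable_range_one_def
    proof (intro ballI impI)
      fix x y assume x: "x \<in> carrier ?T" and y: "y \<in> carrier ?T"
        and "(x <#\<^bsub>?T\<^esub> carrier ?T) <+>\<^bsub>?T\<^esub> (y <#\<^bsub>?T\<^esub> carrier ?T) = carrier ?T"
      then obtain a b where "a \<in> ?E" "b \<in> ?E" "\<forall>z\<in>carrier A. x (a z) \<oplus>\<^bsub>A\<^esub> y (b z) = z"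
        using graded_End_ring_two_generators_iff[OF A x y] by blast
      moreover have x': "x \<in> ?E" and y': "y \<in> ?E" using x y by (simp_all add: T_simps)
      ultimately obtain u where u: "u \<in> ?E"
        and bij: "bij_betw (\<lambda>z. x z \<oplus>\<^bsub>A\<^esub> y (u z)) (carrier A) (carrier A)"
        using unit by blast
      let ?v = "\<lambda>z. x z \<oplus>\<^bsub>A\<^esub> y (u z)" and ?u = "restrict u (carrier A)"
      have v: "?v \<in> ?E" by (intro graded_hom_add[OF A] graded_hom_comp[OF y' u] x')
      have eq: "x \<oplus>\<^bsub>?T\<^esub> y \<otimes>\<^bsub>?T\<^esub> ?u = restrict ?v (carrier A)"
        by (auto simp: T_simps restrict_def)
      \<comment> \<open>The inverse of a bijective graded endomorphism is again graded, so it is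
        available in the ring as a right inverse.\<close>
      have "\<exists>w\<in>?E. \<forall>z\<in>carrier A. restrict ?v (carrier A) (w z) = z"
      proof (intro bexI ballI)
        show w: "inv_into (carrier A) ?v \<in> ?E" by (rule graded_hom_inverse[OF A A v bij])
        fix z assume z: "z \<in> carrier A"
        show "restrict ?v (carrier A) (inv_into (carrier A) ?v z) = z"
          using graded_homD(1)[OF w z] bij_betw_inv_into_right[OF bij z] by simp
      qed
      then have "(x \<oplus>\<^bsub>?T\<^esub> y \<otimes>\<^bsub>?T\<^esub> ?u) <#\<^bsub>?T\<^esub> carrier ?T = carrier ?T"
        unfolding eq using graded_End_ring_right_ideal_iff[OF A restrict_graded_hom[OF A v]] by blast
      then show "\<exists>u\<in>carrier ?T. (x \<oplus>\<^bsub>?T\<^esub> y \<otimes>\<^bsub>?T\<^esub> u) <#\<^bsub>?T\<^esub> carrier ?T = carrier ?T"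
        using restrict_graded_hom[OF A u] by blast
    qed
  qed
qed

section \<open>From stable range 1 to common complements\<close>

lemma stable_range_one_imp_graded_substitution:
  assumes A: "gmod A Ag" and sr: "stable_range_one (graded_End_ring \<Gamma> R A Ag)"
  shows "graded_substitution TYPE('m) \<Gamma> R Rg A Ag"
  unfolding graded_substitution_def
proof (intro allI impI, elim conjE)
  fix M :: "('r, 'm) right_module" and Mg A\<^sub>1 B A' B'
  assume M: "gmod M Mg"
    and A1: "gsub M Mg A\<^sub>1" and B: "gsub M Mg B" and A': "gsub M Mg A'" and B': "gsub M Mg B'"
    and iso: "graded_iso \<Gamma> R A Ag (M\<lparr>carrier := A\<^sub>1\<rparr>) (\<lambda>\<gamma>. A\<^sub>1 \<inter> Mg \<gamma>)"
    and ds: "direct_sum_of M A\<^sub>1 B" and ds': "direct_sum_of M A' B'"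
    and iso': "graded_iso \<Gamma> R A Ag (M\<lparr>carrier := A'\<rparr>) (\<lambda>\<gamma>. A' \<inter> Mg \<gamma>)"
  interpret M: abelian_group M using M by (rule gmod_abelian_group)
  interpret A: abelian_group A using A by (rule gmod_abelian_group)
  obtain i p where i: "i \<in> ghom A Ag M Mg" and p: "p \<in> ghom M Mg A Ag"
    and pi: "\<And>a. a \<in> carrier A \<Longrightarrow> p (i a) = a" and B_eq: "B = {x \<in> carrier M. p x = \<zero>\<^bsub>A\<^esub>}"
    using summand_retraction[OF M A A1 B ds iso] by blast
  obtain j q where j: "j \<in> ghom A Ag M Mg" and q: "q \<in> ghom M Mg A Ag"
    and qj: "\<And>a. a \<in> carrier A \<Longrightarrow> q (j a) = a" and B'_eq: "B' = {x \<in> carrier M. q x = \<zero>\<^bsub>A\<^esub>}"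
    using summand_retraction[OF M A A' B' ds' iso'] by blast
  note closed = graded_homD(1)[OF i] graded_homD(1)[OF j] graded_homD(1)[OF p] graded_homD(1)[OF q]
  \<comment> \<open>\<open>e = 1 - j q\<close> is a projection of \<open>M\<close> onto
    \<open>B'\<close>, the kernel of \<open>q\<close>.\<close>
  define e where "e m = m \<ominus>\<^bsub>M\<^esub> j (q m)" for m
  have e: "e \<in> ghom M Mg M Mg"
    unfolding e_def by (intro graded_hom_minus[OF M] graded_hom_id graded_hom_comp[OF j q])
  have qe: "q (e m) = \<zero>\<^bsub>A\<^esub>" if "m \<in> carrier M" for m
    using that by (simp add: e_def graded_hom_zero_minus[OF M A q] closed qj A.minus_eq A.r_neg)
  \<comment> \<open>This is \<open>p\<close> applied to the splitting
    \<open>i z = j (q (i z)) + e (i z)\<close>.\<close>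
  have "p (j (q (i z))) \<oplus>\<^bsub>A\<^esub> p (e (i z)) = z" if "z \<in> carrier A" for z
    using that
    by (simp add: e_def graded_hom_zero_minus[OF M A p] closed pi A.minus_eq A.r_neg
        A.a_lcomm[of "p (j (q (i z)))"])
  \<comment> \<open>Stable range 1 is used with \<open>x = p j\<close>, \<open>y = p e i\<close>,
    \<open>a = q i\<close> and \<open>b = 1\<close>.\<close>
  then obtain u where u: "u \<in> ghom A Ag A Ag"
    and bij: "bij_betw (\<lambda>z. p (j z) \<oplus>\<^bsub>A\<^esub> p (e (i (u z)))) (carrier A) (carrier A)"
    using sr[unfolded stable_range_one_graded_End_ring_iff[OF A], rule_format,
        OF graded_hom_comp[OF p j] graded_hom_comp[OF p graded_hom_comp[OF e i]]
          graded_hom_comp[OF q i] graded_hom_id]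
    by blast
  \<comment> \<open>The second term is killed by \<open>q\<close>, so \<open>q h = 1\<close>
    whatever \<open>u\<close> is; the choice of \<open>u\<close> makes \<open>p h\<close>
    bijective.\<close>
  define h where "h z = j z \<oplus>\<^bsub>M\<^esub> e (i (u z))" for z
  have h: "h \<in> ghom A Ag M Mg"
    unfolding h_def by (intro graded_hom_add[OF M] j graded_hom_comp[OF e graded_hom_comp[OF i u]])
  note closed = closed graded_homD(1)[OF u] graded_homD(1)[OF e] graded_homD(1)[OF h]
  have ph: "p (h z) = p (j z) \<oplus>\<^bsub>A\<^esub> p (e (i (u z)))" if "z \<in> carrier A" for z
    using that by (simp add: h_def graded_homD(2)[OF p] closed)
  have qh: "q (h z) = z" if "z \<in> carrier A" for z
    using that by (simp add: h_def graded_homD(2)[OF q] closed qj qe)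
  let ?C = "h ` carrier A"
  have C: "gsub M Mg ?C" using A M h by (rule gsub_image)
  have "bij_betw (\<lambda>z. p (h z)) (carrier A) (carrier A)"
    using bij ph by (simp cong: bij_betw_cong)
  \<comment> \<open>Injectivity of the composite \<open>p h\<close> gives injectivity of
    \<open>p\<close> on the image of \<open>h\<close>.\<close>
  then have "bij_betw p ?C (carrier A)"
    by (auto simp: bij_betw_def image_image intro!: inj_on_imageI simp: comp_def)
  moreover have "bij_betw q ?C (carrier A)"
    by (rule bij_betw_byWitness[of _ h]) (auto simp: qh)
  moreover have "p ` carrier M = carrier A" "q ` carrier M = carrier A"
    using closed(1-4) pi qj by (auto intro!: image_eqI[of _ p "i _"] image_eqI[of _ q "j _"])
  ultimately have "direct_sum_of M B ?C" "direct_sum_of M B' ?C"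
    unfolding B_eq B'_eq
    using direct_sum_of_kernel_iff[OF M A p _ C] direct_sum_of_kernel_iff[OF M A q _ C] by blast+
  then show "\<exists>C. gsub M Mg C \<and> direct_sum_of M B C \<and> direct_sum_of M B' C"
    using C by blast
qed

section \<open>From common complements to stable range 1\<close>

lemma graded_substitution_imp_stable_range_one:
  fixes A :: "('r, 'a) right_module"
  assumes A: "gmod A Ag" and subst: "graded_substitution TYPE('a \<times> 'a) \<Gamma> R Rg A Ag"
  shows "stable_range_one (graded_End_ring \<Gamma> R A Ag)"
  unfolding stable_range_one_graded_End_ring_iff[OF A]
proof (intro ballI impI)
  let ?E = "ghom A Ag A Ag"
  fix x y a b assume x: "x \<in> ?E" and y: "y \<in> ?E" and a: "a \<in> ?E" and b: "b \<in> ?E"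
    and one: "\<forall>z\<in>carrier A. x (a z) \<oplus>\<^bsub>A\<^esub> y (b z) = z"
  interpret A: abelian_group A using A by (rule gmod_abelian_group)
  let ?M = "prod_module A A" and ?Mg = "\<lambda>\<gamma>. Ag \<gamma> \<times> Ag \<gamma>"
  have M: "gmod ?M ?Mg" using A A by (rule gmod_prod_module)
  \<comment> \<open>The equation \<open>x a + y b = 1\<close> says that \<open>?i\<close> splits
    \<open>?p\<close>, so the image of \<open>?i\<close> is a copy of \<open>A\<close> that
    complements the kernel of \<open>?p\<close>.\<close>
  let ?i = "\<lambda>z. (a z, b z)" and ?p = "\<lambda>m. x (fst m) \<oplus>\<^bsub>A\<^esub> y (snd m)"
  \<comment> \<open>\<open>z \<ominus> z\<close> is a way to write the zero map as a difference of graded homomorphisms\<close>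
  let ?j = "\<lambda>z. (z, z \<ominus>\<^bsub>A\<^esub> z)"
  have i: "?i \<in> ghom A Ag ?M ?Mg" using a b by (rule graded_hom_Pair)
  have p: "?p \<in> ghom ?M ?Mg A Ag"
    by (intro graded_hom_add[OF A] graded_hom_comp[OF x graded_hom_fst] graded_hom_comp[OF y graded_hom_snd])
  have j: "?j \<in> ghom A Ag ?M ?Mg"
    by (intro graded_hom_Pair graded_hom_minus[OF A] graded_hom_id)
  have pi: "\<And>z. z \<in> carrier A \<Longrightarrow> ?p (?i z) = z" using one by simp
  have qj: "\<And>z. z \<in> carrier A \<Longrightarrow> fst (?j z) = z" by simp
  \<comment> \<open>\<open>?L\<close> is the second factor \<open>0 \<oplus> A\<close>, complemented
    by the first factor, which is the image of \<open>?j\<close>.\<close>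
  let ?K = "{m \<in> carrier ?M. ?p m = \<zero>\<^bsub>A\<^esub>}" and ?L = "{m \<in> carrier ?M. fst m = \<zero>\<^bsub>A\<^esub>}"
  have "\<exists>C. gsub ?M ?Mg C \<and> direct_sum_of ?M ?K C \<and> direct_sum_of ?M ?L C"
    by (rule subst[unfolded graded_substitution_def, rule_format,
          of ?M ?Mg "?i ` carrier A" ?K "?j ` carrier A" ?L])
      (intro conjI M retraction_summand[OF M A i p pi] retraction_summand[OF M A j graded_hom_fst qj])
  then obtain C where C: "gsub ?M ?Mg C" and ds: "direct_sum_of ?M ?K C" "direct_sum_of ?M ?L C"
    by blast
  have "?p ` carrier ?M = carrier A"
  proof (intro equalityI subsetI)
    fix z assume "z \<in> carrier A"
    then show "z \<in> ?p ` carrier ?M"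
      using graded_homD(1)[OF i] pi by (intro image_eqI[of _ _ "?i z"]) simp_all
  qed (use graded_homD(1)[OF p] in blast)
  then have bij_p: "bij_betw ?p C (carrier A)"
    using ds(1) direct_sum_of_kernel_iff[OF M A p _ C] by blast
  have "fst ` carrier ?M = carrier A" using A.zero_closed by (auto simp: image_iff)
  then have bij_fst: "bij_betw fst C (carrier A)"
    using ds(2) direct_sum_of_kernel_iff[OF M A graded_hom_fst _ C] by blast
  let ?MC = "?M\<lparr>carrier := C\<rparr>" and ?Cg = "\<lambda>\<gamma>. C \<inter> ?Mg \<gamma>"
  \<comment> \<open>As \<open>fst\<close> is bijective on \<open>C\<close>, this set is the graph of
    a map \<open>u\<close>, and \<open>h\<close> sends \<open>z\<close> to the pair
    \<open>(z, u z)\<close>.\<close>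
  define h where "h = inv_into C fst"
  have fst_C: "fst \<in> ghom ?MC ?Cg A Ag"
    using graded_hom_comp[OF graded_hom_fst graded_hom_inclusion[OF C]] by simp
  have "h \<in> ghom A Ag ?MC ?Cg"
    using graded_hom_inverse[OF gmod_gsub[OF M C] A fst_C] bij_fst by (simp add: h_def)
  then have h: "h \<in> ghom A Ag ?M ?Mg" by (simp add: graded_hom_gsub_iff[OF A C])
  have fst_h: "fst (h z) = z" if "z \<in> carrier A" for z
    using bij_betw_inv_into_right[OF bij_fst that] by (simp add: h_def)
  \<comment> \<open>The bijection \<open>h\<close> from \<open>A\<close> to \<open>C\<close> is
    followed by \<open>?p\<close>; the value at \<open>z\<close> is \<open>x z + y (u z)\<close>,
    where \<open>u\<close> is the second coordinate of \<open>h\<close>.\<close>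
  have "bij_betw (\<lambda>z. ?p (h z)) (carrier A) (carrier A)"
    using bij_betw_trans[OF bij_betw_inv_into[OF bij_fst] bij_p] by (simp add: h_def comp_def)
  then have "bij_betw (\<lambda>z. x z \<oplus>\<^bsub>A\<^esub> y (snd (h z))) (carrier A) (carrier A)"
    by (simp add: fst_h cong: bij_betw_cong)
  then show "\<exists>u\<in>?E. bij_betw (\<lambda>z. x z \<oplus>\<^bsub>A\<^esub> y (u z)) (carrier A) (carrier A)"
    by (rule bexI[OF _ graded_hom_comp[OF graded_hom_snd h]])
qed

end

text \<open>In place of a quantifier over types there are two instances of graded substitution:
  \<open>'a \<times> 'a\<close> has room for \<open>A \<oplus> A\<close>, from which stable range 1
  is recovered, and the free type variable \<open>'m\<close> stands for an arbitrary type of module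
  elements.\<close>

theorem theorem4p4:
  fixes \<Gamma> :: "'g monoid" and R :: "'r ring" and Rg :: "'g \<Rightarrow> 'r set"
    and A :: "('r, 'a) right_module" and Ag :: "'g \<Rightarrow> 'a set"
  assumes "group \<Gamma>"
    and "graded_ring \<Gamma> R Rg"
    and "graded_module \<Gamma> R Rg A Ag"
  shows "stable_range_one (graded_End_ring \<Gamma> R A Ag) \<longleftrightarrow>
    graded_substitution TYPE('a \<times> 'a) \<Gamma> R Rg A Ag \<and>
    graded_substitution TYPE('m) \<Gamma> R Rg A Ag"
proof -
  interpret graded_ring \<Gamma> R Rg by fact
  show ?thesis
    using stable_range_one_imp_graded_substitution[OF assms(3), where ?'m = "'a \<times> 'a"]
      stable_range_one_imp_graded_substitution[OF assms(3), where ?'m = 'm]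
      graded_substitution_imp_stable_range_one[OF assms(3)]
    by blast
qed

end
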